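(* Let $\mathcal{G}^{gr}$ be the infinite dimensional Grassmann algebra $\mathcal{G}=\langle 1,e_1,e_2,\dots\mid e_ie_j=-e_je_i\rangle$ with the grading whose even part is spanned by the monomials in the $e_i$ of even length and whose odd part is spanned by those of odd length. Then for $n\ge 1$: (1) $c_n^{gr,z}(\mathcal{G}^{gr})=\sum_{1\le i\le n,\ i\text{ odd}}\binom{n}{i}=2^{n-1}$ and $\delta_n^{gr}(\mathcal{G}^{gr})=\sum_{0\le i\le n,\ i\text{ even}}\binom{n}{i}=2^{n-1}$; (2) $\chi_n^{gr,z}(\mathcal{G}^{gr})=\sum_{1\le i\le n,\ i\text{ odd}}\chi_{(n-i),(1^i)}$ and $\chi_n(\Delta^{gr}(\mathcal{G}^{gr}))=\sum_{0\le i\le n,\ i\text{ even}}\chi_{(n-i),(1^i)}$.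
   Context: $F$ is a field of characteristic zero. A superalgebra is an algebra $A=A_0\oplus A_1$ with $A_iA_j\subseteq A_{i+j\bmod 2}$; $Z(A)$ is the center. $F\langle Y,Z\rangle$ is the free algebra on even variables $y_1,y_2,\dots$ and odd variables $z_1,z_2,\dots$. $\mathrm{Id}^{gr}(A)$ is the set of graded identities; $C^{gr}(A)$ is the set of central graded polynomials (zero constant term, all evaluations with even variables in $A_0$ and odd in $A_1$ lie in $Z(A)$). $P_n^{gr}$ is the span of monomials $w_{\sigma(1)}\cdots w_{\sigma(n)}$, $\sigma\in S_n$, $w_i\in\{y_i,z_i\}$; $c_n^{gr,z}(A)=\dim P_n^{gr}/(P_n^{gr}\cap C^{gr}(A))$, $\delta_n^{gr}(A)=\dim(P_n^{gr}\cap C^{gr}(A))/(P_n^{gr}\cap\mathrm{Id}^{gr}(A))$. $\mathbb{Z}_2\wr S_n$ acts on $P_n^{gr}$ by $(a_1,\dots,a_n;\sigma)y_i=y_{\sigma(i)}$, $(a_1,\dots,a_n;\sigma)z_i=a_{\sigma(i)}z_{\sigma(i)}$ ($a_j=\pm1$); $\chi_n^{gr,z}(A)$ and $\chi_n(\Delta^{gr}(A))$ denote the characters of $P_n^{gr}/(P_n^{gr}\cap C^{gr}(A))$ and $(P_n^{gr}\cap C^{gr}(A))/(P_n^{gr}\cap\mathrm{Id}^{gr}(A))$. $\chi_{\lambda,\mu}$ is the irreducible $\mathbb{Z}_2\wr S_n$-character indexed by $\lambda\vdash n-r$ (even variables) and $\mu\vdash r$ (odd variables); $1^i$ denotes the partition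 with $i$ parts equal to $1$. *)

theory Defs
  imports Main HOL.Vector_Spaces "HOL-Library.Function_Algebras" "HOL-Library.FuncSet"
          "HOL-Combinatorics.Permutations"
begin

text \<open>An element of the Grassmann algebra G = <1, e_0, e_1, ... | e_i e_j = - e_j e_i>
  over the field 'a is represented by its coefficient function on the standard basis
  e_A = e_{a_1} ... e_{a_k} (a_1 < ... < a_k), A a finite set of indices.
  (Indexing the generators by nat starting at 0 instead of 1 is immaterial.)\<close>

type_synonym 'a grass = "nat set \<Rightarrow> 'a"

definition grass_carrier :: "'a::field grass set" where
  "grass_carrier = {u. finite {A. u A \<noteq> 0} \<and> (\<forall>A. u A \<noteq> 0 \<longrightarrow> finite A)}"

text \<open>Sign obtained when reordering e_A e_B (A, B disjoint) into e_{A \<union> B}.\<close>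
definition grass_sign :: "nat set \<Rightarrow> nat set \<Rightarrow> 'a::field" where
  "grass_sign A B = (-1) ^ card {(x, y). x \<in> A \<and> y \<in> B \<and> y < x}"

definition grass_mult :: "'a::field grass \<Rightarrow> 'a grass \<Rightarrow> 'a grass" where
  "grass_mult u v = (\<lambda>C. if finite C
      then (\<Sum>A\<in>Pow C. grass_sign A (C - A) * u A * v (C - A)) else 0)"

definition grass_one :: "'a::field grass" where
  "grass_one = (\<lambda>A. if A = {} then 1 else 0)"

definition grass_prod :: "'a::field grass list \<Rightarrow> 'a grass" where
  "grass_prod us = foldr grass_mult us grass_one"

definition grass_even :: "'a::field grass set" where
  "grass_even = {u \<in> grass_carrier. \<forall>A. u A \<noteq> 0 \<longrightarrow> even (card A)}"

definition grass_odd :: "'a::field grass set" where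
  "grass_odd = {u \<in> grass_carrier. \<forall>A. u A \<noteq> 0 \<longrightarrow> odd (card A)}"

definition grass_center :: "'a::field grass set" where
  "grass_center = {u \<in> grass_carrier. \<forall>v \<in> grass_carrier. grass_mult u v = grass_mult v u}"

text \<open>Letters: Inl i is the even variable y_i, Inr i is the odd variable z_i.
  A noncommutative polynomial is a finitely supported coefficient function on words.\<close>

type_synonym 'a fpoly = "(nat + nat) list \<Rightarrow> 'a"

definition letter_index :: "nat + nat \<Rightarrow> nat" where
  "letter_index l = (case l of Inl i \<Rightarrow> i | Inr i \<Rightarrow> i)"

definition fpoly_eval :: "'a::field fpoly \<Rightarrow> (nat \<Rightarrow> 'a grass) \<Rightarrow> (nat \<Rightarrow> 'a grass) \<Rightarrow> 'a grass" where
  "fpoly_eval f ys zs = (\<lambda>C. \<Sum>w\<in>{w. f w \<noteq> 0}.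
      f w * grass_prod (map (\<lambda>l. case l of Inl i \<Rightarrow> ys i | Inr i \<Rightarrow> zs i) w) C)"

definition graded_eval_ok :: "(nat \<Rightarrow> 'a::field grass) \<Rightarrow> (nat \<Rightarrow> 'a grass) \<Rightarrow> bool" where
  "graded_eval_ok ys zs \<longleftrightarrow> (\<forall>i. ys i \<in> grass_even) \<and> (\<forall>i. zs i \<in> grass_odd)"

definition Id_gr :: "'a::field fpoly set" where
  "Id_gr = {f. finite {w. f w \<noteq> 0} \<and>
      (\<forall>ys zs. graded_eval_ok ys zs \<longrightarrow> fpoly_eval f ys zs = (\<lambda>_. 0))}"

definition C_gr :: "'a::field fpoly set" where
  "C_gr = {f. finite {w. f w \<noteq> 0} \<and> f [] = 0 \<and>
      (\<forall>ys zs. graded_eval_ok ys zs \<longrightarrow> fpoly_eval f ys zs \<in> grass_center)}"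

definition multilin_word :: "nat \<Rightarrow> (nat + nat) list \<Rightarrow> bool" where
  "multilin_word n w \<longleftrightarrow> distinct (map letter_index w) \<and> set (map letter_index w) = {1..n}"

definition P_gr :: "nat \<Rightarrow> 'a::field fpoly set" where
  "P_gr n = {f. \<forall>w. f w \<noteq> 0 \<longrightarrow> multilin_word n w}"

abbreviation fscale :: "'a::field \<Rightarrow> 'a fpoly \<Rightarrow> 'a fpoly" where
  "fscale c f \<equiv> (\<lambda>w. c * f w)"

definition fdim :: "'a::field fpoly set \<Rightarrow> nat" where
  "fdim V = vector_space.dim fscale V"

text \<open>Trace of a linear map g on the quotient V/U (U \<subseteq> V, g-invariant): take a basis B of V
  extending a basis BU of U; the classes of B - BU form a basis of V/U.\<close>
definition quot_trace :: "'a::field fpoly set \<Rightarrow> 'a fpoly set \<Rightarrow> ('a fpoly \<Rightarrow> 'a fpoly) \<Rightarrow> 'a" where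
  "quot_trace V U g = (SOME t. \<exists>BU B. BU \<subseteq> B \<and> finite B \<and>
      \<not> module.dependent fscale B \<and> module.span fscale B = V \<and> module.span fscale BU = U \<and>
      t = (\<Sum>b\<in>B - BU. module.representation fscale B (g b) b))"

definition c_gr_z :: "'a::field_char_0 itself \<Rightarrow> nat \<Rightarrow> nat" where
  "c_gr_z _ n = fdim (P_gr n :: 'a fpoly set) - fdim (P_gr n \<inter> C_gr :: 'a fpoly set)"

definition delta_gr :: "'a::field_char_0 itself \<Rightarrow> nat \<Rightarrow> nat" where
  "delta_gr _ n = fdim (P_gr n \<inter> C_gr :: 'a fpoly set) - fdim (P_gr n \<inter> Id_gr :: 'a fpoly set)"

text \<open>Action of (a_1,...,a_n; \<sigma>) \<in> Z_2 wr S_n: y_i \<mapsto> y_{\<sigma> i}, z_i \<mapsto> a_{\<sigma> i} z_{\<sigma> i},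
  extended multiplicatively and linearly. Here \<sigma> permutes {1..n}, a : nat \<Rightarrow> 'a with a j = \<plusminus>1.\<close>
definition wr_act :: "(nat \<Rightarrow> 'a::field) \<Rightarrow> (nat \<Rightarrow> nat) \<Rightarrow> 'a fpoly \<Rightarrow> 'a fpoly" where
  "wr_act a \<sigma> f = (\<lambda>w. prod_list (map (\<lambda>l. case l of Inl _ \<Rightarrow> 1 | Inr j \<Rightarrow> a j) w) *
      f (map (map_sum (inv \<sigma>) (inv \<sigma>)) w))"

definition chi_gr_z :: "nat \<Rightarrow> (nat \<Rightarrow> 'a::field_char_0) \<Rightarrow> (nat \<Rightarrow> nat) \<Rightarrow> 'a" where
  "chi_gr_z n a \<sigma> = quot_trace (P_gr n) (P_gr n \<inter> C_gr) (wr_act a \<sigma>)"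

definition chi_Delta_gr :: "nat \<Rightarrow> (nat \<Rightarrow> 'a::field_char_0) \<Rightarrow> (nat \<Rightarrow> nat) \<Rightarrow> 'a" where
  "chi_Delta_gr n a \<sigma> = quot_trace (P_gr n \<inter> C_gr) (P_gr n \<inter> Id_gr) (wr_act a \<sigma>)"

text \<open>Permutation character of the Young subgroup S_\<alpha> (composition \<alpha>, entries possibly negative,
  in which case it is 0), evaluated at a permutation \<sigma> of the finite set X:
  the number of \<sigma>-invariant ordered set partitions of X with block sizes \<alpha>.\<close>
definition young_perm_char :: "nat set \<Rightarrow> (nat \<Rightarrow> nat) \<Rightarrow> int list \<Rightarrow> int" where
  "young_perm_char X \<sigma> \<alpha> = int (card {f \<in> X \<rightarrow>\<^sub>E {..<length \<alpha>}.
      (\<forall>i<length \<alpha>. int (card {x \<in> X. f x = i}) = \<alpha> ! i) \<and> (\<forall>x\<in>X. f (\<sigma> x) = f x)})"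

text \<open>Irreducible S_X-character \<chi>_\<lambda> (\<lambda> a partition, list of weakly decreasing positive parts),
  via the Frobenius/Jacobi-Trudi determinantal formula \<chi>_\<lambda> = det(\<xi>^{(\<lambda>_i - i + j)}).\<close>
definition sym_char :: "nat list \<Rightarrow> nat set \<Rightarrow> (nat \<Rightarrow> nat) \<Rightarrow> int" where
  "sym_char lam X \<sigma> = (\<Sum>\<pi> | \<pi> permutes {..<length lam}.
      sign \<pi> * young_perm_char X \<sigma> (map (\<lambda>i. int (lam ! i) - int i + int (\<pi> i)) [0..<length lam]))"

text \<open>Irreducible character \<chi>_{\<lambda>,\<mu>} of Z_2 wr S_n, \<lambda> \<turnstile> n - r (even variables), \<mu> \<turnstile> r (odd variables):
  induced from Z_2 wr S_{n-r} \<times> Z_2 wr S_r of \<chi>_\<lambda> \<otimes> (\<epsilon> \<chi>_\<mu>), where Z_2 acts trivially on the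
  first factor and \<epsilon>(a) = \<Prod> a_j on the second. Induced character formula: sum over the \<sigma>-stable
  r-subsets T of {1..n} (the cosets fixed by (a;\<sigma>)).\<close>
definition wr_char :: "nat list \<Rightarrow> nat list \<Rightarrow> nat \<Rightarrow> (nat \<Rightarrow> 'a::field_char_0) \<Rightarrow> (nat \<Rightarrow> nat) \<Rightarrow> 'a" where
  "wr_char lam mu n a \<sigma> = (\<Sum>T | T \<subseteq> {1..n} \<and> card T = sum_list mu \<and> \<sigma> ` T = T.
      of_int (sym_char lam ({1..n} - T) \<sigma> * sym_char mu T \<sigma>) * (\<Prod>j\<in>T. a j))"

definition row_part :: "nat \<Rightarrow> nat list" where
  "row_part k = (if k = 0 then [] else [k])"

definition col_part :: "nat \<Rightarrow> nat list" where
  "col_part k = replicate k 1"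

end

theory Submission
  imports Defs "HOL-Combinatorics.Cycles" "HOL-Combinatorics.Orbits"
    "Jordan_Normal_Form.Determinant"
begin

text \<open>
  Even elements are central and odd elements anticommute, so under a graded evaluation a
  multilinear monomial with odd variables \<open>z\<^sub>i\<close>, \<open>i \<in> T\<close>, depends only on \<open>T\<close> up to the sign of the
  arrangement of the odd letters. Hence a multilinear polynomial is described modulo identities by
  one signed coefficient sum \<open>\<phi>\<^sub>T\<close> for each \<open>T \<subseteq> {1..n}\<close>; it is an identity iff all \<open>\<phi>\<^sub>T\<close> vanish, and
  central iff those with \<open>card T\<close> odd vanish. The canonical monomials are dual to the \<open>\<phi>\<^sub>T\<close>, so the
  trace of \<open>(a; \<sigma>)\<close> on the quotients is the sum of \<open>sgn (\<sigma>|\<^sub>T) \<Prod>j\<in>T. a j\<close> over the \<open>\<sigma>\<close>-stable \<open>T\<close>,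
  and the dimensions are the traces of the identity.

  It remains to see that the Jacobi--Trudi determinant of a column is the sign character. Pieri's
  rule gives by induction, for every hook \<open>(s, 1\<^sup>k)\<close>, the sum of
  \<open>(-1) ^ (card A + s) * sgn (\<sigma>|\<^bsub>X - A\<^esub>)\<close> over the \<open>\<sigma>\<close>-stable \<open>A \<subseteq> X\<close> with \<open>card A \<ge> s\<close>. For a
  column this telescopes by toggling one cycle of \<open>\<sigma>\<close> in and out of \<open>A\<close>, which reverses signs.
\<close>

section \<open>Signs on invariant subsets\<close>

definition invariant_subsets :: "('b \<Rightarrow> 'b) \<Rightarrow> 'b set \<Rightarrow> 'b set set" where
  "invariant_subsets \<sigma> X = {A. A \<subseteq> X \<and> \<sigma> ` A = A}"

lemma finite_invariant_subsets: "finite X \<Longrightarrow> finite (invariant_subsets \<sigma> X)"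
  by (simp add: invariant_subsets_def)

lemma empty_in_invariant_subsets [simp]: "{} \<in> invariant_subsets \<sigma> X"
  by (simp add: invariant_subsets_def)

lemma permutation_inj: "permutation \<sigma> \<Longrightarrow> inj \<sigma>"
  by (simp add: bij_is_inj permutation_bijective)

lemma bij_betw_invariant: "permutation \<sigma> \<Longrightarrow> \<sigma> ` A = A \<Longrightarrow> bij_betw \<sigma> A A"
  by (simp add: bij_betw_def inj_on_subset[OF permutation_inj])

lemma image_Diff_invariant:
  "permutation \<sigma> \<Longrightarrow> \<sigma> ` X = X \<Longrightarrow> \<sigma> ` A = A \<Longrightarrow> \<sigma> ` (X - A) = X - A"
  by (simp add: image_set_diff permutation_inj)

lemma sign_on_empty [simp]: "sign_on {} \<sigma> = 1"
  by (simp add: sign_on_def restrict_id_def)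

lemma sign_on_Un:
  assumes "finite A" "finite B" "A \<inter> B = {}" "bij_betw \<sigma> A A" "bij_betw \<sigma> B B"
  shows "sign_on (A \<union> B) \<sigma> = sign_on A \<sigma> * sign_on B \<sigma>"
proof -
  have "restrict_id \<sigma> (A \<union> B) = restrict_id \<sigma> A \<circ> restrict_id \<sigma> B"
    using assms(3,5) by (auto simp: restrict_id_def fun_eq_iff bij_betw_def)
  moreover have "permutation (restrict_id \<sigma> A)" "permutation (restrict_id \<sigma> B)"
    using assms by (auto intro: permutes_imp_permutation permutes_restrict_id)
  ultimately show ?thesis by (simp add: sign_on_def sign_compose)
qed

lemma sign_cycle_of_list:
  "cs \<noteq> [] \<Longrightarrow> distinct cs \<Longrightarrow> sign (cycle_of_list cs) = (-1) ^ (length cs - 1)"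
proof (induction cs rule: cycle_of_list.induct)
  case (1 i j cs)
  have "sign (transpose i j \<circ> cycle_of_list (j # cs))
      = sign (transpose i j) * sign (cycle_of_list (j # cs))"
    by (intro sign_compose permutation_swap_id permutation_of_cycle)
  with 1 show ?case by (simp add: sign_swap_id comp_def)
qed auto

lemma sign_on_orbit:
  assumes "permutation \<sigma>"
  shows "sign_on (orbit \<sigma> a) \<sigma> = - ((-1) ^ card (orbit \<sigma> a))"
proof -
  define cs where "cs = support \<sigma> a"
  have set_cs: "set cs = orbit \<sigma> a"
    using support_set[OF assms, of a] orbit_altdef_permutation[OF assms, of a]
    by (auto simp: cs_def)
  have "distinct cs"
    unfolding cs_def by (rule cycle_of_permutation[OF assms])
  moreover obtain l where "length cs = Suc l"
    using set_cs permutation_self_in_orbit[OF assms, of a] by (cases cs) auto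
  moreover have "restrict_id \<sigma> (set cs) = cycle_of_list cs"
    using cycle_restrict[OF assms] by (auto simp: fun_eq_iff restrict_id_def cs_def id_outside_supp)
  ultimately show ?thesis
    using sign_cycle_of_list[of cs] distinct_card[of cs]
    by (fastforce simp: sign_on_def simp flip: set_cs)
qed

lemma image_orbit:
  assumes "permutation \<sigma>"
  shows "\<sigma> ` orbit \<sigma> a = orbit \<sigma> a"
proof (rule card_subset_eq)
  show "finite (orbit \<sigma> a)" using assms by (simp add: finite_orbit permutation_self_in_orbit)
  show "\<sigma> ` orbit \<sigma> a \<subseteq> orbit \<sigma> a" by (auto intro: orbit.step)
  show "card (\<sigma> ` orbit \<sigma> a) = card (orbit \<sigma> a)"
    by (rule card_image) (rule inj_on_subset[OF permutation_inj[OF assms] subset_UNIV])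
qed

lemma orbit_subset_invariant: "\<sigma> ` A = A \<Longrightarrow> a \<in> A \<Longrightarrow> orbit \<sigma> a \<subseteq> A"
proof
  fix x assume "\<sigma> ` A = A" "a \<in> A" "x \<in> orbit \<sigma> a"
  from this(3,1,2) show "x \<in> A" by induction auto
qed

lemma orbit_subset_or_disjoint_invariant:
  assumes "permutation \<sigma>" "\<sigma> ` X = X" "a \<in> X" "A \<in> invariant_subsets \<sigma> X"
  shows "orbit \<sigma> a \<subseteq> A \<or> orbit \<sigma> a \<inter> A = {}"
  using assms(3,4) orbit_subset_invariant[of \<sigma> A a] orbit_subset_invariant[of \<sigma> "X - A" a]
    image_Diff_invariant[OF assms(1,2)]
  by (cases "a \<in> A") (auto simp: invariant_subsets_def)

lemma sign_on_Diff_Un_orbit: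
  assumes "finite X" and \<sigma>: "permutation \<sigma>" "\<sigma> ` X = X"
    and A: "A \<in> invariant_subsets \<sigma> X" and orbit: "orbit \<sigma> a \<subseteq> X" "orbit \<sigma> a \<inter> A = {}"
  shows "(-1) ^ card (A \<union> orbit \<sigma> a) * sign_on (X - (A \<union> orbit \<sigma> a)) \<sigma> =
    - ((-1) ^ card A * sign_on (X - A) \<sigma>)"
proof -
  let ?C = "orbit \<sigma> a"
  have invariant: "\<sigma> ` ?C = ?C" "\<sigma> ` (A \<union> ?C) = A \<union> ?C"
    using A by (simp_all add: invariant_subsets_def image_Un image_orbit[OF \<sigma>(1)])
  have fin: "finite A" "finite ?C"
    using A orbit(1) \<open>finite X\<close> finite_subset unfolding invariant_subsets_def by blast+
  have "X - A = (X - (A \<union> ?C)) \<union> ?C" using orbit by auto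
  moreover have "sign_on ((X - (A \<union> ?C)) \<union> ?C) \<sigma> = sign_on (X - (A \<union> ?C)) \<sigma> * sign_on ?C \<sigma>"
    using \<open>finite X\<close> fin invariant(1) image_Diff_invariant[OF \<sigma> invariant(2)]
    by (intro sign_on_Un bij_betw_invariant[OF \<sigma>(1)]) auto
  moreover have "card (A \<union> ?C) = card A + card ?C"
    using fin orbit(2) by (intro card_Un_disjoint) auto
  ultimately show ?thesis
    using sign_on_orbit[OF \<sigma>(1), of a] by (simp add: power_add)
qed


lemma alternating_sum_sign_on:
  assumes "finite X" "X \<noteq> {}" and \<sigma>: "permutation \<sigma>" "\<sigma> ` X = X"
  shows "(\<Sum>A\<in>invariant_subsets \<sigma> X. (-1) ^ card A * sign_on (X - A) \<sigma>) = 0"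
proof -
  let ?I = "invariant_subsets \<sigma> X" and ?t = "\<lambda>A. (-1) ^ card A * sign_on (X - A) \<sigma>"
  obtain a where "a \<in> X" using \<open>X \<noteq> {}\<close> by blast
  define C where "C = orbit \<sigma> a"
  have C: "C \<subseteq> X" "\<sigma> ` C = C" "a \<in> C"
    using \<sigma> \<open>a \<in> X\<close>
    by (simp_all add: C_def orbit_subset_invariant image_orbit permutation_self_in_orbit)
  have C_in_or_out: "C \<subseteq> A \<or> C \<inter> A = {}" if "A \<in> ?I" for A
    unfolding C_def by (rule orbit_subset_or_disjoint_invariant[OF \<sigma> \<open>a \<in> X\<close> that])
  have sign_reversing: "?t (A \<union> C) = - ?t A" if "A \<in> ?I" "C \<inter> A = {}" for A
    using sign_on_Diff_Un_orbit[OF assms(1) \<sigma> that(1)] C(1) that(2) by (simp add: C_def)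
  let ?toggle = "\<lambda>A. if C \<subseteq> A then A - C else A \<union> C"
  have toggle_in: "?toggle A \<in> ?I" if "A \<in> ?I" for A
    using that C image_Diff_invariant[OF \<sigma>(1), of A C]
    by (auto simp: invariant_subsets_def image_Un)
  have toggle_toggle: "?toggle (?toggle A) = A" if "A \<in> ?I" for A
    using C_in_or_out[OF that] C(3) by auto
  have "sum ?t ?I = (\<Sum>A\<in>?I. - ?t A)"
  proof (rule sum.reindex_bij_witness[of _ ?toggle ?toggle])
    fix A assume A: "A \<in> ?I"
    show "- ?t (?toggle A) = ?t A"
    proof (cases "C \<subseteq> A")
      case True
      hence "A - C \<union> C = A" "C \<inter> (A - C) = {}" by auto
      thus ?thesis using True sign_reversing[of "A - C"] toggle_in[OF A] by simp
    next
      case False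
      thus ?thesis using C_in_or_out[OF A] sign_reversing[OF A] by simp
    qed
  qed (simp_all add: toggle_toggle toggle_in)
  thus ?thesis by (simp add: sum_negf)
qed

section \<open>Hook characters\<close>

definition invariant_colourings :: "('b \<Rightarrow> 'b) \<Rightarrow> 'b set \<Rightarrow> nat \<Rightarrow> ('b \<Rightarrow> nat) set" where
  "invariant_colourings \<sigma> X k = {f \<in> X \<rightarrow>\<^sub>E {..<k}. \<forall>x\<in>X. f (\<sigma> x) = f x}"

definition class_sizes :: "'b set \<Rightarrow> nat \<Rightarrow> ('b \<Rightarrow> nat) \<Rightarrow> nat list" where
  "class_sizes X k f = map (\<lambda>i. card {x \<in> X. f x = i}) [0..<k]"

lemma class_sizes_nth: "i < k \<Longrightarrow> class_sizes X k f ! i = card {x \<in> X. f x = i}"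
  by (simp add: class_sizes_def)

lemma finite_invariant_colourings: "finite X \<Longrightarrow> finite (invariant_colourings \<sigma> X k)"
  by (simp add: invariant_colourings_def finite_PiE)

definition add_class :: "'b set \<Rightarrow> 'b set \<Rightarrow> ('b \<Rightarrow> nat) \<Rightarrow> 'b \<Rightarrow> nat" where
  "add_class X A f = restrict (\<lambda>x. if x \<in> A then 0 else Suc (f x)) X"

definition zero_class :: "'b set \<Rightarrow> ('b \<Rightarrow> nat) \<Rightarrow> 'b set" where
  "zero_class X f = {x \<in> X. f x = 0}"

definition remove_class :: "'b set \<Rightarrow> ('b \<Rightarrow> nat) \<Rightarrow> 'b \<Rightarrow> nat" where
  "remove_class X f = restrict (\<lambda>x. f x - 1) (X - zero_class X f)"

lemma zero_class_add_class: "A \<subseteq> X \<Longrightarrow> zero_class X (add_class X A f) = A"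
  by (auto simp: zero_class_def add_class_def)

lemma remove_class_add_class:
  assumes "A \<subseteq> X" "f \<in> extensional (X - A)"
  shows "remove_class X (add_class X A f) = f"
  unfolding remove_class_def zero_class_add_class[OF assms(1)]
  using assms(2) by (auto simp: add_class_def fun_eq_iff extensional_def)

lemma add_class_remove_class:
  "f \<in> extensional X \<Longrightarrow> add_class X (zero_class X f) (remove_class X f) = f"
  by (auto simp: add_class_def remove_class_def zero_class_def fun_eq_iff extensional_def)

lemma add_class_in_invariant_colourings:
  assumes "A \<in> invariant_subsets \<sigma> X" "\<sigma> ` (X - A) = X - A"
    and "f \<in> invariant_colourings \<sigma> (X - A) k"
  shows "add_class X A f \<in> invariant_colourings \<sigma> X (Suc k)"
proof -
  have "\<sigma> x \<in> A" if "x \<in> A" for x using that assms(1) by (auto simp: invariant_subsets_def)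
  moreover have "\<sigma> x \<in> X - A" if "x \<in> X" "x \<notin> A" for x using that assms(2) by blast
  moreover have "A \<subseteq> X" using assms(1) by (simp add: invariant_subsets_def)
  ultimately show ?thesis
    using assms(3) by (auto simp: add_class_def invariant_colourings_def PiE_def Pi_def)
qed

lemma zero_class_in_invariant_subsets:
  assumes "finite X" "permutation \<sigma>" "\<sigma> ` X = X" "f \<in> invariant_colourings \<sigma> X k"
  shows "zero_class X f \<in> invariant_subsets \<sigma> X"
proof -
  have "\<sigma> ` zero_class X f = zero_class X f"
  proof (rule card_subset_eq)
    show "finite (zero_class X f)" using assms(1) by (simp add: zero_class_def)
    show "\<sigma> ` zero_class X f \<subseteq> zero_class X f"
      using assms(3,4) by (auto simp: zero_class_def invariant_colourings_def)
    show "card (\<sigma> ` zero_class X f) = card (zero_class X f)"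
      by (rule card_image) (rule inj_on_subset[OF permutation_inj[OF assms(2)] subset_UNIV])
  qed
  thus ?thesis by (auto simp: invariant_subsets_def zero_class_def)
qed

lemma remove_class_in_invariant_colourings:
  assumes "finite X" "permutation \<sigma>" "\<sigma> ` X = X" "f \<in> invariant_colourings \<sigma> X (Suc k)"
  shows "remove_class X f \<in> invariant_colourings \<sigma> (X - zero_class X f) k"
proof -
  let ?A = "zero_class X f"
  have "\<sigma> ` ?A = ?A"
    using zero_class_in_invariant_subsets[OF assms] by (simp add: invariant_subsets_def)
  hence "\<sigma> x \<in> X - ?A" if "x \<in> X - ?A" for x
    using image_Diff_invariant[OF assms(2,3), of ?A] that by blast
  moreover have "f x - 1 < k" if "x \<in> X - ?A" for x
  proof -
    have "f x < Suc k" "f x \<noteq> 0"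
      using assms(4) that by (auto simp: invariant_colourings_def zero_class_def)
    thus ?thesis by simp
  qed
  ultimately show ?thesis
    using assms(4) by (simp add: invariant_colourings_def remove_class_def)
qed

lemma class_sizes_add_class:
  assumes "A \<subseteq> X"
  shows "class_sizes X (Suc k) (add_class X A f) = card A # class_sizes (X - A) k f"
proof -
  have "{x \<in> X. add_class X A f x = 0} = A" using assms by (auto simp: add_class_def)
  moreover have "{x \<in> X. add_class X A f x = Suc i} = {x \<in> X - A. f x = i}" for i
    by (auto simp: add_class_def)
  ultimately show ?thesis
    unfolding class_sizes_def upt_conv_Cons[OF zero_less_Suc] map_Suc_upt[symmetric]
    by (simp del: upt_Suc)
qed

lemma sum_invariant_colourings_Suc:
  assumes "finite X" and \<sigma>: "permutation \<sigma>" "\<sigma> ` X = X"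
  shows "(\<Sum>f\<in>invariant_colourings \<sigma> X (Suc k). F (class_sizes X (Suc k) f)) =
    (\<Sum>A\<in>invariant_subsets \<sigma> X. \<Sum>f\<in>invariant_colourings \<sigma> (X - A) k.
       F (card A # class_sizes (X - A) k f))"
    (is "_ = (\<Sum>A\<in>?I. \<Sum>f\<in>?C A. ?F A f)")
proof -
  have "(\<Sum>(A, f)\<in>Sigma ?I ?C. ?F A f) =
      (\<Sum>f\<in>invariant_colourings \<sigma> X (Suc k). F (class_sizes X (Suc k) f))"
  proof (rule sum.reindex_bij_witness[where j = "\<lambda>(A, f). add_class X A f"
        and i = "\<lambda>f. (zero_class X f, remove_class X f)"])
    fix p assume "p \<in> Sigma ?I ?C"
    then obtain A f where p: "p = (A, f)" "A \<in> ?I" "f \<in> ?C A" by auto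
    have A: "A \<subseteq> X" "\<sigma> ` A = A" using p(2) by (auto simp: invariant_subsets_def)
    have "f \<in> extensional (X - A)" using p(3) by (simp add: invariant_colourings_def PiE_def)
    thus "(zero_class X ((\<lambda>(A, f). add_class X A f) p),
        remove_class X ((\<lambda>(A, f). add_class X A f) p)) = p"
      using A(1) by (simp add: p(1) zero_class_add_class remove_class_add_class)
    show "(\<lambda>(A, f). add_class X A f) p \<in> invariant_colourings \<sigma> X (Suc k)"
      using add_class_in_invariant_colourings[OF p(2) image_Diff_invariant[OF \<sigma> A(2)] p(3)]
      by (simp add: p(1))
    show "F (class_sizes X (Suc k) ((\<lambda>(A, f). add_class X A f) p)) = (\<lambda>(A, f). ?F A f) p"
      by (simp add: p(1) class_sizes_add_class[OF A(1)])
  next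
    fix f assume f: "f \<in> invariant_colourings \<sigma> X (Suc k)"
    have "f \<in> extensional X" using f by (simp add: invariant_colourings_def PiE_def)
    thus "(\<lambda>(A, f). add_class X A f) (zero_class X f, remove_class X f) = f"
      by (simp add: add_class_remove_class)
    show "(zero_class X f, remove_class X f) \<in> Sigma ?I ?C"
      using zero_class_in_invariant_subsets[OF assms f]
        remove_class_in_invariant_colourings[OF assms f] by blast
  qed
  thus ?thesis
    using assms(1) finite_invariant_subsets[OF assms(1), of \<sigma>]
    by (subst sum.Sigma) (simp_all add: finite_invariant_colourings)
qed

lemma young_perm_char_map:
  assumes "finite X"
  shows "young_perm_char X \<sigma> (map g [0..<k]) =
    (\<Sum>f\<in>invariant_colourings \<sigma> X k. \<Prod>i<k. of_bool (int (class_sizes X k f ! i) = g i))"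
proof -
  have "young_perm_char X \<sigma> (map g [0..<k]) =
      int (card {f \<in> invariant_colourings \<sigma> X k. \<forall>i<k. int (class_sizes X k f ! i) = g i})"
    unfolding young_perm_char_def invariant_colourings_def
    by (intro arg_cong[of _ _ int] arg_cong[of _ _ card]) (auto simp: class_sizes_nth)
  also have "\<dots> = (\<Sum>f\<in>invariant_colourings \<sigma> X k.
      of_bool (\<forall>i<k. int (class_sizes X k f ! i) = g i))"
    using finite_invariant_colourings[OF assms] by (simp add: of_bool_def sum.If_cases Int_def)
  also have "\<dots> = (\<Sum>f\<in>invariant_colourings \<sigma> X k.
      \<Prod>i<k. of_bool (int (class_sizes X k f ! i) = g i))"
    by (intro sum.cong) (auto simp: of_bool_def intro!: prod.neutral)
  finally show ?thesis .
qed

text \<open>The contribution of the ordered set partitions with block sizes \<open>ms\<close> to the Jacobi--Trudi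
  determinant of \<open>lam\<close>: the entry of index \<open>lam\<^sub>i - i + j\<close> only counts \<open>ms\<^sub>i = lam\<^sub>i - i + j\<close>.\<close>

definition jacobi_trudi :: "nat list \<Rightarrow> nat list \<Rightarrow> int" where
  "jacobi_trudi lam ms =
     det (mat (length lam) (length lam) (\<lambda>(i, j). of_bool (ms ! i + i = lam ! i + j)))"

lemma sym_char_eq_sum_jacobi_trudi:
  assumes "finite X"
  shows "sym_char lam X \<sigma> =
    (\<Sum>f\<in>invariant_colourings \<sigma> X (length lam). jacobi_trudi lam (class_sizes X (length lam) f))"
proof -
  let ?k = "length lam" and ?m = "\<lambda>f i. class_sizes X (length lam) f ! i"
  have "sym_char lam X \<sigma> = (\<Sum>f\<in>invariant_colourings \<sigma> X ?k. \<Sum>\<pi> | \<pi> permutes {..<?k}.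
      sign \<pi> * (\<Prod>i<?k. of_bool (int (?m f i) = int (lam ! i) - int i + int (\<pi> i))))"
    unfolding sym_char_def young_perm_char_map[OF assms] sum_distrib_left by (rule sum.swap)
  also have "\<dots> = (\<Sum>f\<in>invariant_colourings \<sigma> X ?k. jacobi_trudi lam (class_sizes X ?k f))"
  proof (rule sum.cong[OF refl])
    fix f
    have "int (?m f i) = int (lam ! i) - int i + int (\<pi> i) \<longleftrightarrow> ?m f i + i = lam ! i + \<pi> i" for \<pi> i
      by linarith
    moreover have "\<pi> i < ?k" if "\<pi> permutes {..<?k}" "i < ?k" for \<pi> i
      using permutes_in_image[OF that(1), of i] that(2) by simp
    ultimately show "(\<Sum>\<pi> | \<pi> permutes {..<?k}.
        sign \<pi> * (\<Prod>i<?k. of_bool (int (?m f i) = int (lam ! i) - int i + int (\<pi> i)))) =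
        jacobi_trudi lam (class_sizes X ?k f)"
      unfolding jacobi_trudi_def
      by (subst det_def'[of _ ?k]) (auto simp: atLeast0LessThan intro!: sum.cong prod.cong)
  qed
  finally show ?thesis .
qed

lemma jacobi_trudi_hook:
  "jacobi_trudi (s # replicate (Suc k) 1) (m0 # m1 # ms) =
     of_bool (m0 = s) * jacobi_trudi (replicate (Suc k) 1) (m1 # ms)
   - of_bool (m1 = 0) * jacobi_trudi (Suc s # replicate k 1) (m0 # ms)"
proof -
  define M :: "int mat" where "M = mat (k + 2) (k + 2)
    (\<lambda>(i, j). of_bool ((m0 # m1 # ms) ! i + i = (s # replicate (Suc k) 1) ! i + j))"
  have "jacobi_trudi (s # replicate (Suc k) 1) (m0 # m1 # ms) = det M"
    by (simp add: jacobi_trudi_def M_def)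
  also have "\<dots> = (\<Sum>i<k + 2. M $$ (i, 0) * cofactor M i 0)"
    by (rule laplace_expansion_column) (simp_all add: M_def)
  also have "\<dots> = M $$ (0, 0) * cofactor M 0 0 + M $$ (1, 0) * cofactor M 1 0"
  proof -
    have "(\<Sum>i<k. M $$ (Suc (Suc i), 0) * cofactor M (Suc (Suc i)) 0) = 0"
      by (rule sum.neutral) (auto simp: M_def)
    thus ?thesis by (simp add: sum.lessThan_Suc_shift del: sum.lessThan_Suc)
  qed
  also have "M $$ (0, 0) = of_bool (m0 = s)" by (simp add: M_def)
  also have "M $$ (1, 0) = of_bool (m1 = 0)" by (simp add: M_def)
  also have "cofactor M 0 0 = jacobi_trudi (replicate (Suc k) 1) (m1 # ms)"
    unfolding cofactor_def jacobi_trudi_def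
    by (simp, intro arg_cong[of _ _ det] eq_matI) (auto simp: mat_delete_def M_def nth_Cons')
  also have "cofactor M 1 0 = - jacobi_trudi (Suc s # replicate k 1) (m0 # ms)"
    unfolding cofactor_def jacobi_trudi_def
    by (simp, intro arg_cong[of _ _ det] eq_matI) (auto simp: mat_delete_def M_def nth_Cons')
  finally show ?thesis by simp
qed

lemma sum_invariant_subsets_card_0:
  assumes "finite X"
  shows "(\<Sum>B\<in>invariant_subsets \<sigma> X. of_bool (card B = 0) * F B) = (F {} :: int)"
proof -
  have "card B = 0 \<longleftrightarrow> B = {}" if "B \<in> invariant_subsets \<sigma> X" for B
    using that assms by (auto simp: invariant_subsets_def dest: finite_subset)
  hence "(\<Sum>B\<in>invariant_subsets \<sigma> X. of_bool (card B = 0) * F B) =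
      (\<Sum>B\<in>invariant_subsets \<sigma> X. if B = {} then F B else 0)"
    by (intro sum.cong) auto
  thus ?thesis using finite_invariant_subsets[OF assms] by simp
qed

lemma sym_char_hook_Pieri:
  assumes "finite X" and \<sigma>: "permutation \<sigma>" "\<sigma> ` X = X"
  shows "sym_char (s # replicate (Suc k) 1) X \<sigma> + sym_char (Suc s # replicate k 1) X \<sigma> =
    (\<Sum>A\<in>invariant_subsets \<sigma> X. of_bool (card A = s) * sym_char (replicate (Suc k) 1) (X - A) \<sigma>)"
proof -
  let ?I = "invariant_subsets \<sigma>" and ?C = "invariant_colourings \<sigma>"
  have sum_Suc: "(\<Sum>f\<in>?C (X - A) (Suc l). F (class_sizes (X - A) (Suc l) f)) =
      (\<Sum>B\<in>?I (X - A). \<Sum>f\<in>?C (X - A - B) l. F (card B # class_sizes (X - A - B) l f))"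
    if "A \<in> ?I X" for A l and F :: "nat list \<Rightarrow> int"
    using that assms by (intro sum_invariant_colourings_Suc)
      (auto simp: invariant_subsets_def image_Diff_invariant)
  have "sym_char (s # replicate (Suc k) 1) X \<sigma> =
      (\<Sum>A\<in>?I X. \<Sum>B\<in>?I (X - A). \<Sum>f\<in>?C (X - A - B) k.
        jacobi_trudi (s # replicate (Suc k) 1) (card A # card B # class_sizes (X - A - B) k f))"
    using assms(1) sum_Suc[where F = "\<lambda>ms. jacobi_trudi (s # replicate (Suc k) 1) (_ # ms)"]
    by (simp add: sym_char_eq_sum_jacobi_trudi sum_invariant_colourings_Suc[OF assms]
        del: replicate_Suc One_nat_def)
  also have "\<dots> = (\<Sum>A\<in>?I X. of_bool (card A = s) * (\<Sum>B\<in>?I (X - A). \<Sum>f\<in>?C (X - A - B) k.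
        jacobi_trudi (replicate (Suc k) 1) (card B # class_sizes (X - A - B) k f)))
    - (\<Sum>A\<in>?I X. \<Sum>B\<in>?I (X - A). of_bool (card B = 0) * (\<Sum>f\<in>?C (X - A - B) k.
        jacobi_trudi (Suc s # replicate k 1) (card A # class_sizes (X - A - B) k f)))"
    by (simp add: jacobi_trudi_hook sum_subtractf sum_distrib_left del: replicate_Suc One_nat_def)
  also have "(\<Sum>A\<in>?I X. of_bool (card A = s) * (\<Sum>B\<in>?I (X - A). \<Sum>f\<in>?C (X - A - B) k.
        jacobi_trudi (replicate (Suc k) 1) (card B # class_sizes (X - A - B) k f))) =
      (\<Sum>A\<in>?I X. of_bool (card A = s) * sym_char (replicate (Suc k) 1) (X - A) \<sigma>)"
    using assms(1) by (intro sum.cong)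
      (simp_all add: sym_char_eq_sum_jacobi_trudi sum_Suc del: replicate_Suc One_nat_def)
  also have "(\<Sum>A\<in>?I X. \<Sum>B\<in>?I (X - A). of_bool (card B = 0) * (\<Sum>f\<in>?C (X - A - B) k.
        jacobi_trudi (Suc s # replicate k 1) (card A # class_sizes (X - A - B) k f))) =
      sym_char (Suc s # replicate k 1) X \<sigma>"
    using assms(1)
    by (simp add: sym_char_eq_sum_jacobi_trudi sum_invariant_colourings_Suc[OF assms]
        sum_invariant_subsets_card_0)
  finally show ?thesis by simp
qed

lemma sym_char_singleton:
  assumes "finite X" "\<sigma> ` X \<subseteq> X"
  shows "sym_char [card X] X \<sigma> = 1"
proof -
  have "{x \<in> X. restrict (\<lambda>_. 0) X x = 0} = X" by auto
  hence "{f \<in> X \<rightarrow>\<^sub>E {..<Suc 0}. card {x \<in> X. f x = 0} = card X \<and> (\<forall>x\<in>X. f (\<sigma> x) = f x)} =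
      {restrict (\<lambda>_. 0) X}"
    using assms by (auto simp: fun_eq_iff PiE_def extensional_def)
  moreover have "{p. p permutes {..<Suc 0}} = {id}"
    by (auto simp: lessThan_Suc)
  ultimately show ?thesis
    by (simp add: sym_char_def young_perm_char_def)
qed

lemma sym_char_Nil: "sym_char [] {} \<sigma> = 1"
  by (simp add: sym_char_def young_perm_char_def)

definition hook_sum :: "(nat \<Rightarrow> nat) \<Rightarrow> nat set \<Rightarrow> nat \<Rightarrow> int" where
  "hook_sum \<sigma> X s =
     (\<Sum>A\<in>invariant_subsets \<sigma> X. of_bool (s \<le> card A) * ((-1) ^ (card A + s) * sign_on (X - A) \<sigma>))"

lemma hook_sum_Suc:
  "hook_sum \<sigma> X s + hook_sum \<sigma> X (Suc s) =
    (\<Sum>A\<in>invariant_subsets \<sigma> X. of_bool (card A = s) * sign_on (X - A) \<sigma>)"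
  unfolding hook_sum_def sum.distrib[symmetric]
proof (rule sum.cong[OF refl])
  fix A
  show "of_bool (s \<le> card A) * ((-1) ^ (card A + s) * sign_on (X - A) \<sigma>) +
      of_bool (Suc s \<le> card A) * ((-1) ^ (card A + Suc s) * sign_on (X - A) \<sigma>) =
      of_bool (card A = s) * sign_on (X - A) \<sigma>"
    by (cases "card A = s") (auto simp flip: mult_2)
qed

lemma hook_sum_card:
  assumes "finite X" "\<sigma> ` X = X"
  shows "hook_sum \<sigma> X (card X) = 1"
proof -
  have "card X \<le> card A \<longleftrightarrow> A = X" if "A \<in> invariant_subsets \<sigma> X" for A
    using that card_seteq[OF assms(1)] by (auto simp: invariant_subsets_def)
  hence "hook_sum \<sigma> X (card X) = (\<Sum>A\<in>invariant_subsets \<sigma> X. if A = X then 1 else 0)"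
    unfolding hook_sum_def by (intro sum.cong) (auto simp flip: mult_2)
  thus ?thesis
    using assms finite_invariant_subsets[OF assms(1)] by (simp add: invariant_subsets_def)
qed

lemma hook_sum_1:
  assumes "finite X" "X \<noteq> {}" "permutation \<sigma>" "\<sigma> ` X = X"
  shows "hook_sum \<sigma> X 1 = sign_on X \<sigma>"
proof -
  have "hook_sum \<sigma> X 0 = 0"
    using alternating_sum_sign_on[OF assms] by (simp add: hook_sum_def)
  thus ?thesis
    using hook_sum_Suc[of \<sigma> X 0] sum_invariant_subsets_card_0[OF assms(1)] by simp
qed

theorem sym_char_hook:
  assumes "finite X" "permutation \<sigma>" "\<sigma> ` X = X" "card X = s + k"
  shows "sym_char (s # replicate k 1) X \<sigma> = hook_sum \<sigma> X s"
  using assms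
proof (induction k arbitrary: s X)
  case 0
  thus ?case using sym_char_singleton[of X \<sigma>] hook_sum_card[of X \<sigma>] by simp
next
  case (Suc k)
  have column: "sym_char (replicate (Suc k) 1) (X - A) \<sigma> = sign_on (X - A) \<sigma>"
    if A: "A \<in> invariant_subsets \<sigma> X" "card A = s" for A
  proof -
    have invariant: "\<sigma> ` (X - A) = X - A"
      using A image_Diff_invariant[OF Suc.prems(2,3), of A] by (simp add: invariant_subsets_def)
    have card_Diff: "card (X - A) = 1 + k"
      using A Suc.prems finite_subset[of A X] by (simp add: invariant_subsets_def card_Diff_subset)
    hence "X - A \<noteq> {}" by (metis card.empty add_is_0 one_neq_zero)
    thus ?thesis
      using Suc.IH[OF _ Suc.prems(2) invariant card_Diff]
        hook_sum_1[OF _ _ Suc.prems(2) invariant] Suc.prems(1) by simp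
  qed
  have "sym_char (s # replicate (Suc k) 1) X \<sigma> + sym_char (Suc s # replicate k 1) X \<sigma> =
      (\<Sum>A\<in>invariant_subsets \<sigma> X. of_bool (card A = s) * sign_on (X - A) \<sigma>)"
    unfolding sym_char_hook_Pieri[OF Suc.prems(1-3)]
    by (intro sum.cong) (simp_all add: column del: replicate_Suc One_nat_def)
  moreover have "sym_char (Suc s # replicate k 1) X \<sigma> = hook_sum \<sigma> X (Suc s)"
    using Suc.IH[of X "Suc s"] Suc.prems by simp
  ultimately show ?case using hook_sum_Suc[of \<sigma> X s] by linarith
qed

corollary sym_char_column:
  assumes "finite X" "permutation \<sigma>" "\<sigma> ` X = X"
  shows "sym_char (col_part (card X)) X \<sigma> = sign_on X \<sigma>"
proof (cases "card X")
  case 0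
  thus ?thesis using assms by (simp add: col_part_def sym_char_Nil)
next
  case (Suc k)
  hence "X \<noteq> {}" by auto
  thus ?thesis
    using sym_char_hook[OF assms, of 1 k] hook_sum_1[OF assms(1) _ assms(2,3)] Suc
    by (simp add: col_part_def)
qed

corollary sym_char_row:
  assumes "finite X" "\<sigma> ` X \<subseteq> X"
  shows "sym_char (row_part (card X)) X \<sigma> = 1"
  using assms by (cases "X = {}") (simp_all add: row_part_def sym_char_Nil sym_char_singleton)

section \<open>The Grassmann algebra\<close>

lemma grass_sign_eq_prod:
  assumes "finite A" "finite B"
  shows "grass_sign A B = (\<Prod>x\<in>A. \<Prod>y\<in>B. if y < x then -1 else 1 :: 'a::field)"
proof -
  have "(\<Prod>x\<in>A. \<Prod>y\<in>B. if y < x then -1 else 1 :: 'a) =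
      (\<Prod>p\<in>A \<times> B. if snd p < fst p then -1 else 1)"
    by (simp only: prod.cartesian_product case_prod_unfold)
  also have "\<dots> = (-1) ^ card ((A \<times> B) \<inter> {p. snd p < fst p})"
    using assms by (simp add: prod.If_cases)
  also have "(A \<times> B) \<inter> {p. snd p < fst p} = {(x, y). x \<in> A \<and> y \<in> B \<and> y < x}" by auto
  finally show ?thesis by (simp add: grass_sign_def)
qed

lemma grass_sign_Un_left:
  assumes "finite A" "finite B" "finite C" "A \<inter> B = {}"
  shows "grass_sign (A \<union> B) C = grass_sign A C * (grass_sign B C :: 'a::field)"
  using assms by (simp add: grass_sign_eq_prod prod.union_disjoint)

lemma grass_sign_Un_right:
  assumes "finite A" "finite B" "finite C" "B \<inter> C = {}"
  shows "grass_sign A (B \<union> C) = grass_sign A B * (grass_sign A C :: 'a::field)"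
  using assms by (simp add: grass_sign_eq_prod prod.union_disjoint prod.distrib)

lemma grass_sign_swap:
  assumes "finite A" "finite B" "A \<inter> B = {}"
  shows "grass_sign A B = (-1) ^ (card A * card B) * (grass_sign B A :: 'a::field)"
proof -
  have "grass_sign A B = (\<Prod>x\<in>A. \<Prod>y\<in>B. (-1) * (if x < y then -1 else 1 :: 'a))"
    unfolding grass_sign_eq_prod[OF assms(1,2)] using assms(3) by (intro prod.cong) auto
  also have "\<dots> = (-1) ^ (card A * card B) * (\<Prod>x\<in>A. \<Prod>y\<in>B. if x < y then -1 else 1)"
    by (simp only: prod.distrib prod_constant mult.commute[of "card A" "card B"] flip: power_mult)
  also have "(\<Prod>x\<in>A. \<Prod>y\<in>B. if x < y then -1 else 1 :: 'a) = grass_sign B A"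
    unfolding grass_sign_eq_prod[OF assms(2,1)] by (rule prod.swap)
  finally show ?thesis .
qed

lemma grass_sign_nonzero [simp]: "grass_sign A B \<noteq> (0 :: 'a::field)"
  by (simp add: grass_sign_def)

lemma grass_mult_assoc:
  fixes u v w :: "'a::field grass"
  shows "grass_mult (grass_mult u v) w = grass_mult u (grass_mult v w)"
proof
  fix C
  show "grass_mult (grass_mult u v) w C = grass_mult u (grass_mult v w) C"
  proof (cases "finite C")
    case True
    hence fin: "finite A" if "A \<subseteq> C" for A using that by (rule finite_subset[rotated])
    let ?l = "\<lambda>A B. grass_sign A (C - A) * (grass_sign B (A - B) * u B * v (A - B)) * w (C - A)"
    let ?r = "\<lambda>B D. grass_sign B (C - B) * u B * (grass_sign D (C - B - D) * v D * w (C - B - D))"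
    have "grass_mult (grass_mult u v) w C = (\<Sum>A\<in>Pow C. \<Sum>B\<in>Pow A. ?l A B)"
      using True by (simp add: grass_mult_def fin sum_distrib_left sum_distrib_right)
    also have "\<dots> = (\<Sum>(A, B)\<in>Sigma (Pow C) Pow. ?l A B)"
      using True by (intro sum.Sigma) (auto intro: fin)
    also have "\<dots> = (\<Sum>(B, D)\<in>Sigma (Pow C) (\<lambda>B. Pow (C - B)). ?r B D)"
    proof (rule sum.reindex_bij_witness[of _ "\<lambda>(B, D). (B \<union> D, B)" "\<lambda>(A, B). (B, A - B)"])
      fix p assume "p \<in> Sigma (Pow C) Pow"
      then obtain A B where p: "p = (A, B)" and AB: "B \<subseteq> A" "A \<subseteq> C" by auto
      let ?D = "A - B" and ?E = "C - A"
      have E: "C - B - ?D = ?E" and Un: "B \<union> ?D = A" "?D \<union> ?E = C - B" using AB by auto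
      have "finite B" "finite ?D" "finite ?E" using AB by (auto intro: fin)
      hence "grass_sign A ?E = grass_sign B ?E * (grass_sign ?D ?E :: 'a)"
        and "grass_sign B (C - B) = grass_sign B ?D * (grass_sign B ?E :: 'a)"
        using grass_sign_Un_left[of B ?D ?E] grass_sign_Un_right[of B ?D ?E] AB
        unfolding Un by blast+
      hence "?r B ?D = ?l A B" by (simp add: E ac_simps)
      thus "(\<lambda>(B, D). ?r B D) ((\<lambda>(A, B). (B, A - B)) p) = (\<lambda>(A, B). ?l A B) p"
        by (simp add: p)
    qed auto
    also have "\<dots> = (\<Sum>B\<in>Pow C. \<Sum>D\<in>Pow (C - B). ?r B D)"
      using True by (intro sum.Sigma[symmetric]) auto
    also have "\<dots> = grass_mult u (grass_mult v w) C"
      using True by (simp add: grass_mult_def sum_distrib_left)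
    finally show ?thesis .
  qed (simp add: grass_mult_def)
qed

definition grass_scale :: "'a::field \<Rightarrow> 'a grass \<Rightarrow> 'a grass" where
  "grass_scale c u = (\<lambda>A. c * u A)"

lemma grass_scale_1 [simp]: "grass_scale 1 u = u"
  and grass_scale_0 [simp]: "grass_scale 0 u = (\<lambda>_. 0)"
  and grass_scale_scale [simp]: "grass_scale c (grass_scale d u) = grass_scale (c * d) u"
  by (simp_all add: grass_scale_def mult.assoc)

lemma grass_mult_scale_left [simp]:
    "grass_mult (grass_scale c u) v = grass_scale c (grass_mult u v)"
  and grass_mult_scale_right [simp]:
    "grass_mult u (grass_scale c v) = grass_scale c (grass_mult u v)"
  by (auto simp: grass_scale_def grass_mult_def fun_eq_iff sum_distrib_left ac_simps)

lemma grass_mult_zero_left [simp]: "grass_mult (\<lambda>_. 0) u = (\<lambda>_. 0 :: 'a::field)"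
  and grass_mult_zero_right [simp]: "grass_mult u (\<lambda>_. 0) = (\<lambda>_. 0 :: 'a::field)"
  by (auto simp: grass_mult_def fun_eq_iff)

lemma grass_mult_nonzeroE:
  fixes u v :: "'a::field grass"
  assumes "grass_mult u v C \<noteq> 0"
  obtains A where "finite C" "A \<subseteq> C" "u A \<noteq> 0" "v (C - A) \<noteq> 0"
proof -
  have C: "finite C" using assms by (auto simp: grass_mult_def split: if_splits)
  hence "(\<Sum>A\<in>Pow C. grass_sign A (C - A) * u A * v (C - A)) \<noteq> 0"
    using assms by (simp add: grass_mult_def)
  then obtain A where "A \<in> Pow C" "grass_sign A (C - A) * u A * v (C - A) \<noteq> 0"
    by (rule sum.not_neutral_contains_not_neutral)
  thus ?thesis using that C by auto
qed

lemma grass_mult_carrier: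
  assumes "u \<in> grass_carrier" "v \<in> grass_carrier"
  shows "grass_mult u v \<in> (grass_carrier :: 'a::field grass set)"
proof -
  have "{C. grass_mult u v C \<noteq> 0} \<subseteq> (\<lambda>(A, B). A \<union> B) ` ({A. u A \<noteq> 0} \<times> {B. v B \<noteq> 0})"
  proof
    fix C assume "C \<in> {C. grass_mult u v C \<noteq> 0}"
    hence "grass_mult u v C \<noteq> 0" by simp
    then obtain A where "A \<subseteq> C" "u A \<noteq> 0" "v (C - A) \<noteq> 0"
      by (rule grass_mult_nonzeroE)
    thus "C \<in> (\<lambda>(A, B). A \<union> B) ` ({A. u A \<noteq> 0} \<times> {B. v B \<noteq> 0})"
      by (intro image_eqI[of _ _ "(A, C - A)"]) auto
  qed
  hence "finite {C. grass_mult u v C \<noteq> 0}"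
    by (rule finite_subset) (use assms in \<open>simp add: grass_carrier_def\<close>)
  moreover have "finite C" if "grass_mult u v C \<noteq> 0" for C
    using that by (rule grass_mult_nonzeroE)
  ultimately show ?thesis by (simp add: grass_carrier_def)
qed

definition grass_component :: "nat \<Rightarrow> 'a::field grass set" where
  "grass_component i = {u \<in> grass_carrier. \<forall>A. u A \<noteq> 0 \<longrightarrow> even (card A + i)}"

lemma grass_even_eq_component: "grass_even = grass_component 0"
  and grass_odd_eq_component: "grass_odd = grass_component 1"
  by (simp_all add: grass_even_def grass_odd_def grass_component_def)

lemma grass_component_cong_even: "even i \<Longrightarrow> grass_component i = grass_component 0"
  by (simp add: grass_component_def)

lemma grass_scale_component: "u \<in> grass_component i \<Longrightarrow> grass_scale c u \<in> grass_component i"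
  using finite_subset[of "{A. c * u A \<noteq> 0}" "{A. u A \<noteq> 0}"]
  by (auto simp: grass_component_def grass_carrier_def grass_scale_def)

lemma grass_zero_component [simp]: "(\<lambda>_. 0) \<in> grass_component i"
  by (simp add: grass_component_def grass_carrier_def)

lemma grass_add_component:
  assumes "u \<in> grass_component i" "v \<in> grass_component i"
  shows "(\<lambda>A. u A + v A) \<in> (grass_component i :: 'a::field grass set)"
proof -
  have nonzero: "u A \<noteq> 0 \<or> v A \<noteq> 0" if "u A + v A \<noteq> 0" for A using that by auto
  have "finite ({A. u A \<noteq> 0} \<union> {A. v A \<noteq> 0})"
    using assms by (simp add: grass_component_def grass_carrier_def)
  hence "finite {A. u A + v A \<noteq> 0}"
    by (rule finite_subset[rotated]) (use nonzero in blast)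
  moreover have "finite A \<and> even (card A + i)" if "u A + v A \<noteq> 0" for A
    using nonzero[OF that] assms unfolding grass_component_def grass_carrier_def by blast
  ultimately show ?thesis by (simp add: grass_component_def grass_carrier_def)
qed

lemma grass_sum_component:
  assumes "\<And>t. t \<in> S \<Longrightarrow> g t \<in> grass_component i"
  shows "(\<lambda>A. \<Sum>t\<in>S. g t A) \<in> (grass_component i :: 'a::field grass set)"
  using assms by (induction S rule: infinite_finite_induct) (simp_all add: grass_add_component)

lemma grass_mult_component:
  assumes "u \<in> grass_component i" "v \<in> grass_component j"
  shows "grass_mult u v \<in> (grass_component (i + j) :: 'a::field grass set)"
proof -
  have "even (card C + (i + j))" if C: "grass_mult u v C \<noteq> 0" for C
  proof -
    obtain A where A: "finite C" "A \<subseteq> C" "u A \<noteq> 0" "v (C - A) \<noteq> 0"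
      using C by (rule grass_mult_nonzeroE)
    hence "even (card A + i)" "even (card (C - A) + j)"
      using assms by (auto simp: grass_component_def)
    moreover have "card C = card A + card (C - A)"
      using A by (metis card_Un_disjoint Diff_disjoint Diff_partition finite_subset finite_Diff)
    ultimately show ?thesis by auto
  qed
  thus ?thesis using assms by (simp add: grass_component_def grass_mult_carrier)
qed

lemma grass_mult_supercommute:
  fixes u v :: "'a::field grass"
  assumes "\<And>A B. u A \<noteq> 0 \<Longrightarrow> v B \<noteq> 0 \<Longrightarrow> (-1) ^ (card A * card B) = c"
  shows "grass_mult u v = grass_scale c (grass_mult v u)"
proof
  fix C
  show "grass_mult u v C = grass_scale c (grass_mult v u) C"
  proof (cases "finite C")
    case True
    have "(\<Sum>A\<in>Pow C. grass_sign A (C - A) * u A * v (C - A)) =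
        (\<Sum>A\<in>Pow C. c * (grass_sign A (C - A) * v A * u (C - A)))"
    proof (rule sum.reindex_bij_witness[of _ "\<lambda>A. C - A" "\<lambda>A. C - A"])
      fix A assume A: "A \<in> Pow C"
      have sign: "grass_sign A (C - A) =
          (-1) ^ (card A * card (C - A)) * (grass_sign (C - A) A :: 'a)"
        using A finite_subset[OF _ True] by (intro grass_sign_swap) auto
      have "C - (C - A) = A" using A by auto
      thus "c * (grass_sign (C - A) (C - (C - A)) * v (C - A) * u (C - (C - A))) =
          grass_sign A (C - A) * u A * v (C - A)"
        using assms[of A "C - A"] by (cases "u A = 0 \<or> v (C - A) = 0") (auto simp: sign)
    qed auto
    thus ?thesis using True by (simp add: grass_mult_def grass_scale_def sum_distrib_left)
  qed (simp add: grass_mult_def grass_scale_def)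
qed

lemma grass_mult_component_commute:
  assumes "u \<in> grass_component i" "v \<in> grass_component j"
  shows "grass_mult u v = grass_scale ((-1) ^ (i * j)) (grass_mult v (u :: 'a::field grass))"
proof (rule grass_mult_supercommute)
  fix A B assume "u A \<noteq> 0" "v B \<noteq> 0"
  hence "even (card A) = even i" "even (card B) = even j"
    using assms by (auto simp: grass_component_def)
  thus "(-1 :: 'a) ^ (card A * card B) = (-1) ^ (i * j)" by (simp add: minus_one_power_iff)
qed

lemma grass_mult_left_commute:
  assumes "u \<in> grass_component i" "v \<in> grass_component j"
  shows "grass_mult u (grass_mult v w) =
    grass_scale ((-1) ^ (i * j)) (grass_mult v (grass_mult u (w :: 'a::field grass)))"
  by (simp add: grass_mult_component_commute[OF assms] flip: grass_mult_assoc)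

lemma grass_component_0_center: "u \<in> grass_component 0 \<Longrightarrow> u \<in> (grass_center :: 'a::field grass set)"
  using grass_mult_supercommute[of u _ 1] by (simp add: grass_component_def grass_center_def)

definition grass_basis :: "nat set \<Rightarrow> 'a::field grass" where
  "grass_basis T = (\<lambda>A. of_bool (A = T))"

lemma grass_basis_self [simp]: "grass_basis T T = 1"
  by (simp add: grass_basis_def)

lemma grass_one_eq_basis: "grass_one = grass_basis {}"
  by (simp add: grass_one_def grass_basis_def fun_eq_iff)

lemma grass_basis_component: "finite T \<Longrightarrow> grass_basis T \<in> grass_component (card T)"
  by (simp add: grass_basis_def grass_component_def grass_carrier_def)

lemma grass_one_component: "grass_one \<in> grass_component 0"
  and grass_generator_component: "grass_basis {i} \<in> grass_component 1"
  by (simp_all add: grass_one_eq_basis grass_basis_def grass_component_def grass_carrier_def)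

lemma grass_mult_basis:
  assumes "finite A" "finite B" "A \<inter> B = {}"
  shows "grass_mult (grass_basis A) (grass_basis B) =
    grass_scale (grass_sign A B) (grass_basis (A \<union> B) :: 'a::field grass)"
proof
  fix C
  have "grass_sign D (C - D) * grass_basis A D * grass_basis B (C - D) =
      (if D = A then grass_sign A B * of_bool (C = A \<union> B) else 0 :: 'a)" if "D \<subseteq> C" for D
    using that assms(3) by (auto simp: grass_basis_def)
  hence "(\<Sum>D\<in>Pow C. grass_sign D (C - D) * grass_basis A D * grass_basis B (C - D)) =
      (\<Sum>D\<in>Pow C. if D = A then grass_sign A B * of_bool (C = A \<union> B) else 0 :: 'a)"
    by (intro sum.cong) auto
  moreover have "(\<Sum>D\<in>Pow C. if D = A then grass_sign A B * of_bool (C = A \<union> B) else 0 :: 'a) =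
      grass_sign A B * of_bool (C = A \<union> B)" if "finite C"
    using that by auto
  moreover have "C \<noteq> A \<union> B" if "infinite C" using that assms(1,2) by auto
  ultimately show "grass_mult (grass_basis A) (grass_basis B) C =
      grass_scale (grass_sign A B) (grass_basis (A \<union> B) :: 'a grass) C"
    by (cases "finite C")
      (simp_all add: grass_mult_def grass_scale_def, simp_all add: grass_basis_def)
qed

text \<open>\<open>e\<^sub>i\<close> anticommutes with every odd \<open>e\<^sub>T\<close> not involving it, and \<open>2 \<noteq> 0\<close>.\<close>

lemma scaled_odd_basis_central_imp_zero:
  fixes c :: "'a::field_char_0"
  assumes "grass_scale c (grass_basis T) \<in> grass_center" "finite T" "odd (card T)"
  shows "c = 0"
proof -
  obtain i where i: "i \<notin> T" using ex_new_if_finite[OF infinite_UNIV_nat assms(2)] by blast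
  let ?e = "grass_basis {i} :: 'a grass"
  let ?x = "grass_mult (grass_basis T) ?e"
  have "?e \<in> grass_carrier" by (simp add: grass_basis_def grass_carrier_def)
  hence "grass_mult (grass_scale c (grass_basis T)) ?e =
      grass_mult ?e (grass_scale c (grass_basis T))"
    using assms(1) unfolding grass_center_def by blast
  hence "grass_scale c ?x = grass_scale c (grass_mult ?e (grass_basis T))" by simp
  also have "grass_mult ?e (grass_basis T) = grass_scale (-1) ?x"
    using assms(3) grass_mult_component_commute[OF grass_generator_component
        grass_basis_component[OF assms(2)]] by simp
  finally have "c * ?x (insert i T) = c * (-1 * ?x (insert i T))"
    unfolding grass_scale_def by (rule fun_cong)
  moreover have "?x = grass_scale (grass_sign T {i}) (grass_basis (insert i T))"
    using assms(2) i by (subst grass_mult_basis) auto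
  ultimately show "c = 0" by (simp add: grass_scale_def)
qed

section \<open>Evaluating words\<close>

lemma grass_prod_Nil [simp]: "grass_prod [] = grass_one"
  and grass_prod_Cons [simp]: "grass_prod (u # us) = grass_mult u (grass_prod us)"
  by (simp_all add: grass_prod_def)

lemma grass_prod_eq_zero: "(\<lambda>_. 0) \<in> set us \<Longrightarrow> grass_prod us = (\<lambda>_. 0 :: 'a::field)"
  by (induction us) auto

definition odd_indices :: "(nat + nat) list \<Rightarrow> nat list" where
  "odd_indices w = map projr (filter (\<lambda>l. \<not> isl l) w)"

lemma odd_indices_simps [simp]:
  "odd_indices [] = []"
  "odd_indices (Inl i # w) = odd_indices w"
  "odd_indices (Inr i # w) = i # odd_indices w"
  "odd_indices (v @ w) = odd_indices v @ odd_indices w"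
  by (simp_all add: odd_indices_def)

lemma set_odd_indices: "set (odd_indices w) = {i. Inr i \<in> set w}"
  by (force simp: odd_indices_def)

lemma odd_indices_map_sum [simp]: "odd_indices (map (map_sum f g) w) = map g (odd_indices w)"
  by (induction w) (auto simp: odd_indices_def map_sum_sel isl_map_sum)

lemma distinct_odd_indices: "distinct w \<Longrightarrow> distinct (odd_indices w)"
  by (auto simp: odd_indices_def distinct_map intro!: inj_onI intro: sum.expand)

definition word_eval ::
    "(nat \<Rightarrow> 'a::field grass) \<Rightarrow> (nat \<Rightarrow> 'a grass) \<Rightarrow> (nat + nat) list \<Rightarrow> 'a grass" where
  "word_eval ys zs w = grass_prod (map (case_sum ys zs) w)"

lemma word_eval_Nil [simp]: "word_eval ys zs [] = grass_one"
  and word_eval_Cons [simp]: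
    "word_eval ys zs (l # w) = grass_mult (case_sum ys zs l) (word_eval ys zs w)"
  by (simp_all add: word_eval_def)

lemma word_eval_cong:
  assumes "\<And>i. Inl i \<in> set w \<Longrightarrow> ys i = ys' i" "\<And>i. Inr i \<in> set w \<Longrightarrow> zs i = zs' i"
  shows "word_eval ys zs w = word_eval ys' zs' w"
proof -
  have "case_sum ys zs l = case_sum ys' zs' l" if "l \<in> set w" for l
    by (cases l) (use that assms in simp_all)
  thus ?thesis by (simp add: word_eval_def cong: map_cong)
qed

lemma word_eval_append_cong:
  "word_eval ys zs v = grass_scale c (word_eval ys zs w) \<Longrightarrow>
   word_eval ys zs (u @ v) = grass_scale c (word_eval ys zs (u @ w))"
  by (induction u) simp_all

lemma word_eval_map_sum:
  "word_eval ys zs (map (map_sum f g) w) = word_eval (ys \<circ> f) (zs \<circ> g) w"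
  by (simp add: word_eval_def case_sum_o_map_sum)

lemma case_sum_component:
  "graded_eval_ok ys zs \<Longrightarrow> case_sum ys zs l \<in> grass_component (if isl l then 0 else 1)"
  by (cases l) (simp_all add: graded_eval_ok_def grass_even_eq_component grass_odd_eq_component)

lemma word_eval_component:
  assumes "graded_eval_ok ys zs"
  shows "word_eval ys zs w \<in> grass_component (length (odd_indices w))"
proof (induction w)
  case Nil
  show ?case by (simp add: grass_one_component)
next
  case (Cons l w)
  show ?case using grass_mult_component[OF case_sum_component[OF assms, of l] Cons.IH]
    by (cases l) simp_all
qed

lemma word_eval_move_front:
  assumes "graded_eval_ok ys zs"
  shows "word_eval ys zs (v @ l # w) =
    grass_scale ((-1) ^ (if isl l then 0 else length (odd_indices v)))
      (word_eval ys zs (l # v @ w))"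
proof (induction v)
  case (Cons x v)
  show ?case
    using Cons.IH grass_mult_left_commute[OF case_sum_component[OF assms, of x]
        case_sum_component[OF assms, of l], of "word_eval ys zs (v @ w)"]
    by (cases x; cases l) simp_all
qed simp

lemma word_eval_swap_odd:
  assumes "graded_eval_ok ys zs"
  shows "word_eval ys zs (u @ Inr j # v @ Inr i # w) =
    grass_scale (-1) (word_eval ys zs (u @ Inr i # v @ Inr j # w))"
proof (rule word_eval_append_cong)
  let ?e = "word_eval ys zs" and ?s = "(-1) ^ length (odd_indices v)"
  have "?e (Inr j # v @ Inr i # w) = grass_scale ?s (?e (Inr j # Inr i # v @ w))"
    using word_eval_move_front[OF assms, of v "Inr i" w] by simp
  also have "?e (Inr j # Inr i # v @ w) = grass_scale (-1) (?e (Inr i # Inr j # v @ w))"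
    using word_eval_move_front[OF assms, of "[Inr j]" "Inr i" "v @ w"] by simp
  also have "grass_scale ?s (grass_scale (-1) (?e (Inr i # Inr j # v @ w))) =
      grass_scale (-1) (?e (Inr i # v @ Inr j # w))"
    using word_eval_move_front[OF assms, of v "Inr j" w] by (simp add: mult.commute)
  finally show "word_eval ys zs (Inr j # v @ Inr i # w) =
      grass_scale (-1) (word_eval ys zs (Inr i # v @ Inr j # w))" .
qed

lemma word_eval_transpose_odd:
  assumes "graded_eval_ok ys zs" "distinct w" "Inr i \<in> set w" "Inr j \<in> set w" "i \<noteq> j"
  shows "word_eval ys (zs \<circ> transpose i j) w = grass_scale (-1) (word_eval ys zs w)"
proof -
  have split: "word_eval ys (zs \<circ> transpose i j) w = grass_scale (-1) (word_eval ys zs w)"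
    if w: "w = u @ Inr i # v @ Inr j # x" for i j u v x
  proof -
    have fixed: "map (map_sum id (transpose i j)) y = y" if "Inr i \<notin> set y" "Inr j \<notin> set y"
      for y :: "(nat + nat) list"
    proof (rule map_idI)
      fix l assume l: "l \<in> set y"
      show "map_sum id (transpose i j) l = l"
      proof (cases l)
        case (Inr k)
        hence "k \<noteq> i" "k \<noteq> j" using l that by blast+
        thus ?thesis by (simp add: Inr transpose_apply_other)
      qed simp
    qed
    have "word_eval ys (zs \<circ> transpose i j) w =
        word_eval ys zs (map (map_sum id (transpose i j)) w)"
      by (simp add: word_eval_map_sum)
    also have "map (map_sum id (transpose i j)) w = u @ Inr j # v @ Inr i # x"
      using assms(2) by (simp add: w fixed)
    also have "word_eval ys zs (u @ Inr j # v @ Inr i # x) = grass_scale (-1) (word_eval ys zs w)"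
      unfolding w by (rule word_eval_swap_odd[OF assms(1)])
    finally show ?thesis .
  qed
  obtain u x where w: "w = u @ Inr i # x" using assms(3) by (meson split_list)
  hence "Inr j \<in> set u \<or> Inr j \<in> set x" using assms(4,5) by auto
  thus ?thesis
  proof
    assume "Inr j \<in> set x"
    then obtain v y where "x = v @ Inr j # y" by (meson split_list)
    thus ?thesis using split[of u i v j y] w by simp
  next
    assume "Inr j \<in> set u"
    then obtain v y where "u = v @ Inr j # y" by (meson split_list)
    thus ?thesis using split[of v j y i x] w by (simp add: transpose_commute)
  qed
qed

lemma word_eval_permute_odd:
  assumes "graded_eval_ok ys zs" "distinct w" "p permutes set (odd_indices w)"
  shows "word_eval ys (zs \<circ> p) w = grass_scale (of_int (sign p)) (word_eval ys zs w)"
  using assms(3) finite_set assms(1)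
proof (induction arbitrary: zs rule: permutes_induct)
  case id
  show ?case by simp
next
  case (swap i j p)
  have ok: "graded_eval_ok ys (zs \<circ> transpose i j)"
    using swap.prems by (simp add: graded_eval_ok_def)
  have sign: "sign (transpose i j \<circ> p) = - sign p"
    using swap.hyps(3) permutes_imp_permutation[OF finite_set swap.hyps(4)]
    by (simp add: sign_compose permutation_swap_id sign_swap_id)
  have "word_eval ys (zs \<circ> (transpose i j \<circ> p)) w =
      grass_scale (of_int (sign p)) (word_eval ys (zs \<circ> transpose i j) w)"
    unfolding o_assoc by (rule swap.IH[OF ok])
  also have "word_eval ys (zs \<circ> transpose i j) w = grass_scale (-1) (word_eval ys zs w)"
    using swap.hyps
    by (intro word_eval_transpose_odd swap.prems assms(2)) (auto simp: set_odd_indices)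
  finally show ?case unfolding sign by simp
qed

lemma word_eval_eq_up_to_sign:
  assumes "mset v = mset w"
  obtains c where "\<And>ys zs. graded_eval_ok ys zs \<Longrightarrow>
    word_eval ys zs v = grass_scale c (word_eval ys zs w :: 'a::field grass)"
  using assms
proof (induction w arbitrary: v thesis)
  case Nil
  show ?case by (rule Nil(1)[of 1]) (use Nil(2) in simp)
next
  case (Cons l w)
  have "l \<in> set v" using Cons.prems(2) by (metis list.set_intros(1) set_mset_mset)
  then obtain x y where v: "v = x @ l # y" by (meson split_list)
  hence "mset (x @ y) = mset w" using Cons.prems(2) by simp
  then obtain c :: 'a where "\<And>ys zs. graded_eval_ok ys zs \<Longrightarrow>
      word_eval ys zs (x @ y) = grass_scale c (word_eval ys zs w)"
    using Cons.IH by blast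
  thus ?case
    by (intro Cons.prems(1)) (simp add: v word_eval_move_front)
qed

abbreviation standard_eval :: "(nat + nat) list \<Rightarrow> 'a::field grass" where
  "standard_eval \<equiv> word_eval (\<lambda>_. grass_one) (\<lambda>i. grass_basis {i})"

text \<open>The sign with which the generators indexed by \<open>odd_indices w\<close> multiply to \<open>\<plusminus> e\<^sub>T\<close>.\<close>

definition word_sign :: "(nat + nat) list \<Rightarrow> 'a::field" where
  "word_sign w = standard_eval w (set (odd_indices w))"

lemma graded_eval_ok_standard: "graded_eval_ok (\<lambda>_. grass_one) (\<lambda>i. grass_basis {i})"
  unfolding graded_eval_ok_def grass_even_eq_component grass_odd_eq_component
  by (intro conjI allI grass_one_component grass_generator_component)

lemma word_eval_sorted:
  assumes "sorted_wrt (<) (odd_indices w)"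
  shows "standard_eval w =
    (grass_basis (set (odd_indices w)) :: 'a::field grass)"
  using assms
proof (induction w)
  case Nil
  show ?case by (simp add: grass_one_eq_basis)
next
  case (Cons l w)
  show ?case
  proof (cases l)
    case (Inl i)
    have "grass_sign {} (set (odd_indices w)) = (1 :: 'a)" by (simp add: grass_sign_def)
    thus ?thesis using Cons Inl by (simp add: grass_one_eq_basis grass_mult_basis)
  next
    case (Inr i)
    have no_inversion: "{(x, y). x \<in> {i} \<and> y \<in> set (odd_indices w) \<and> y < x} = {}"
      using Cons.prems Inr by fastforce
    have "grass_sign {i} (set (odd_indices w)) = (1 :: 'a)"
      unfolding grass_sign_def no_inversion by simp
    moreover have "{i} \<inter> set (odd_indices w) = {}" using Cons.prems Inr by auto
    ultimately show ?thesis using Cons Inr by (simp add: grass_mult_basis)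
  qed
qed

lemma word_sign_sorted: "sorted_wrt (<) (odd_indices w) \<Longrightarrow> word_sign w = 1"
  by (simp add: word_sign_def word_eval_sorted)

lemma word_eval_eq_word_sign_scale:
  fixes ys zs :: "nat \<Rightarrow> 'a::field grass"
  assumes "graded_eval_ok ys zs" "mset v = mset w" "sorted_wrt (<) (odd_indices w)"
  shows "word_eval ys zs v = grass_scale (word_sign v) (word_eval ys zs w)"
proof -
  obtain c :: 'a where c: "\<And>ys zs. graded_eval_ok ys zs \<Longrightarrow>
      word_eval ys zs v = grass_scale c (word_eval ys zs w)"
    using word_eval_eq_up_to_sign[OF assms(2)] by blast
  have "set (odd_indices v) = set (odd_indices w)"
    using mset_eq_setD[OF assms(2)] by (simp add: set_odd_indices)
  hence "word_sign v = c"
    by (simp add: word_sign_def c[OF graded_eval_ok_standard] word_eval_sorted[OF assms(3)]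
        grass_scale_def)
  thus ?thesis using c[OF assms(1)] by simp
qed

lemma word_sign_map_sum:
  assumes "distinct w" "sorted_wrt (<) (odd_indices w)"
    and "bij_betw \<sigma> (set (odd_indices w)) (set (odd_indices w))"
  shows "word_sign (map (map_sum f \<sigma>) w) = (of_int (sign_on (set (odd_indices w)) \<sigma>) :: 'a::field)"
proof -
  let ?T = "set (odd_indices w)" and ?e = "\<lambda>i. grass_basis {i} :: 'a grass"
  have "word_eval (\<lambda>_. grass_one) ?e (map (map_sum f \<sigma>) w) =
      word_eval (\<lambda>_. grass_one) (?e \<circ> restrict_id \<sigma> ?T) w"
    unfolding word_eval_map_sum by (rule word_eval_cong) (simp_all add: set_odd_indices)
  also have "\<dots> = grass_scale (of_int (sign_on ?T \<sigma>)) (grass_basis ?T)"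
    using word_eval_permute_odd[OF graded_eval_ok_standard assms(1)
        permutes_restrict_id[OF assms(3)]]
    by (simp add: word_eval_sorted[OF assms(2)] sign_on_def)
  finally show ?thesis
    using assms(3) by (simp add: word_sign_def grass_scale_def bij_betw_def)
qed

section \<open>Dimensions and traces of quotients\<close>

text \<open>The functionals \<open>\<phi> t\<close> induce the basis of \<open>(V/U)\<^sup>*\<close> dual to the classes of the \<open>d t\<close>.\<close>

locale dual_system = vector_space scale
  for scale :: "'a::field \<Rightarrow> 'b::ab_group_add \<Rightarrow> 'b" +
  fixes V U :: "'b set" and D :: "'t set" and d :: "'t \<Rightarrow> 'b" and \<phi> :: "'t \<Rightarrow> 'b \<Rightarrow> 'a"
  assumes subspace_V: "subspace V"
    and finite_D: "finite D"
    and d_in_V: "t \<in> D \<Longrightarrow> d t \<in> V"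
    and linear_functional: "t \<in> D \<Longrightarrow> Vector_Spaces.linear scale (*) (\<phi> t)"
    and dual: "t \<in> D \<Longrightarrow> t' \<in> D \<Longrightarrow> \<phi> t (d t') = of_bool (t = t')"
    and U_eq: "U = {v \<in> V. \<forall>t\<in>D. \<phi> t v = 0}"
begin

definition adapted_basis :: "'b set \<Rightarrow> 'b set \<Rightarrow> bool" where
  "adapted_basis BU B \<longleftrightarrow>
     BU \<subseteq> B \<and> finite B \<and> independent B \<and> span B = V \<and> span BU = U"

lemmas functional_simps =
  linear_functional[THEN Vector_Spaces.linear.axioms(3), THEN module_hom.add]
  linear_functional[THEN Vector_Spaces.linear.axioms(3), THEN module_hom.scale]
  linear_functional[THEN Vector_Spaces.linear.axioms(3), THEN module_hom.diff]
  linear_functional[THEN Vector_Spaces.linear.axioms(3), THEN module_hom.zero]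
  linear_functional[THEN Vector_Spaces.linear.axioms(3), THEN module_hom.sum]

lemma subspace_U: "subspace U"
  using subspace_V by (auto simp: subspace_def U_eq functional_simps)

lemma exists_adapted_basis:
  assumes "finite S" "V \<subseteq> span S"
  obtains BU B where "adapted_basis BU B"
proof -
  obtain BU where BU: "BU \<subseteq> U" "independent BU" "U \<subseteq> span BU"
    by (rule maximal_independent_subset)
  have "BU \<subseteq> V" using BU(1) by (auto simp: U_eq)
  then obtain B where B: "BU \<subseteq> B" "B \<subseteq> V" "independent B" "V \<subseteq> span B"
    by (rule maximal_independent_subset_extend[OF _ BU(2)])
  have "finite B"
    using independent_span_bound[OF assms(1) B(3) subset_trans[OF B(2) assms(2)]] ..
  moreover have "span B = V" using B(4) span_minimal[OF B(2) subspace_V] by blast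
  moreover have "span BU = U" using BU(3) span_minimal[OF BU(1) subspace_U] by blast
  ultimately show ?thesis using B by (intro that[of BU B]) (simp add: adapted_basis_def)
qed

lemma diff_projection_in_U:
  assumes "v \<in> V"
  shows "v - (\<Sum>t\<in>D. scale (\<phi> t v) (d t)) \<in> U"
proof -
  have "v - (\<Sum>t\<in>D. scale (\<phi> t v) (d t)) \<in> V"
    by (intro subspace_diff[OF subspace_V assms] subspace_sum[OF subspace_V]
        subspace_scale[OF subspace_V] d_in_V)
  moreover have "\<phi> t (v - (\<Sum>t\<in>D. scale (\<phi> t v) (d t))) = 0" if "t \<in> D" for t
  proof -
    have "(\<Sum>t'\<in>D. \<phi> t' v * \<phi> t (d t')) = (\<Sum>t'\<in>D. if t' = t then \<phi> t v else 0)"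
      using that by (intro sum.cong) (auto simp: dual)
    thus ?thesis using that finite_D by (simp add: functional_simps)
  qed
  ultimately show ?thesis by (simp add: U_eq)
qed

lemma representation_eq_sum_functionals:
  assumes "adapted_basis BU B" "v \<in> V" "b \<in> B - BU"
  shows "representation B v b = (\<Sum>t\<in>D. \<phi> t v * representation B (d t) b)"
proof -
  have B: "BU \<subseteq> B" "independent B" "span B = V" "span BU = U"
    using assms(1) by (auto simp: adapted_basis_def)
  let ?p = "\<Sum>t\<in>D. scale (\<phi> t v) (d t)"
  have terms_in: "scale (\<phi> t v) (d t) \<in> span B" if "t \<in> D" for t
    using that B(3) by (simp add: d_in_V subspace_scale[OF subspace_V])
  have "v - ?p \<in> span BU" using diff_projection_in_U[OF assms(2)] B(4) by simp
  hence "representation B (v - ?p) b = representation BU (v - ?p) b"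
    using B(1,2) by (simp add: representation_extend)
  also have "\<dots> = 0" using assms(3) representation_ne_zero[of BU "v - ?p" b] by auto
  also have "representation B (v - ?p) b = representation B v b - representation B ?p b"
    using assms(2) B(3) span_sum[of D "\<lambda>t. scale (\<phi> t v) (d t)" B] terms_in
    by (simp add: representation_diff[OF B(2)])
  also have "representation B ?p b = (\<Sum>t\<in>D. \<phi> t v * representation B (d t) b)"
    using terms_in d_in_V B(3)
    by (simp add: representation_sum[OF B(2)] representation_scale[OF B(2)])
  finally show ?thesis by simp
qed

lemma functional_eq_sum_representation:
  assumes "adapted_basis BU B" "Vector_Spaces.linear scale (*) \<psi>" "\<And>u. u \<in> U \<Longrightarrow> \<psi> u = 0" "v \<in> V"
  shows "\<psi> v = (\<Sum>b\<in>B - BU. representation B v b * \<psi> b)"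
proof -
  interpret \<psi>: Vector_Spaces.linear scale "(*)" \<psi> by (rule assms(2))
  have B: "BU \<subseteq> B" "finite B" "independent B" "span B = V" "span BU = U"
    using assms(1) by (auto simp: adapted_basis_def)
  have "(\<Sum>b\<in>B. scale (representation B v b) b) = v"
    using sum_representation_eq[OF B(3) _ B(2)] B(4) assms(4) by simp
  hence "\<psi> v = \<psi> (\<Sum>b\<in>B. scale (representation B v b) b)" by simp
  also have "\<dots> = (\<Sum>b\<in>B. representation B v b * \<psi> b)"
    by (simp add: \<psi>.sum \<psi>.scale)
  finally have "\<psi> v = (\<Sum>b\<in>B. representation B v b * \<psi> b)" .
  moreover have "\<psi> b = 0" if "b \<in> BU" for b
    using assms(3) span_base[OF that] B(5) by simp
  hence "(\<Sum>b\<in>B. representation B v b * \<psi> b) = (\<Sum>b\<in>B - BU. representation B v b * \<psi> b)"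
    using B(1,2) by (intro sum.mono_neutral_right) auto
  ultimately show ?thesis by simp
qed

lemma quotient_trace_eq_sum_functionals:
  assumes "adapted_basis BU B" "Vector_Spaces.linear scale scale g"
    and "\<And>v. v \<in> V \<Longrightarrow> g v \<in> V" "\<And>u. u \<in> U \<Longrightarrow> g u \<in> U"
  shows "(\<Sum>b\<in>B - BU. representation B (g b) b) = (\<Sum>t\<in>D. \<phi> t (g (d t)))"
proof -
  have in_V: "b \<in> V" if "b \<in> B" for b
    using span_base[OF that] assms(1) by (simp add: adapted_basis_def)
  have "(\<Sum>b\<in>B - BU. representation B (g b) b) =
      (\<Sum>b\<in>B - BU. \<Sum>t\<in>D. \<phi> t (g b) * representation B (d t) b)"
    by (intro sum.cong refl representation_eq_sum_functionals[OF assms(1)] assms(3) in_V) auto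
  also have "\<dots> = (\<Sum>t\<in>D. \<Sum>b\<in>B - BU. representation B (d t) b * (\<phi> t \<circ> g) b)"
    by (subst sum.swap) (simp add: mult.commute)
  also have "\<dots> = (\<Sum>t\<in>D. (\<phi> t \<circ> g) (d t))"
  proof (rule sum.cong[OF refl], rule functional_eq_sum_representation[OF assms(1), symmetric])
    fix t assume t: "t \<in> D"
    show "Vector_Spaces.linear scale (*) (\<phi> t \<circ> g)"
      by (rule Vector_Spaces.linear_compose[OF assms(2) linear_functional[OF t]])
    show "(\<phi> t \<circ> g) u = 0" if "u \<in> U" for u using assms(4)[OF that] t by (simp add: U_eq)
    show "d t \<in> V" by (rule d_in_V[OF t])
  qed
  finally show ?thesis by simp
qed

lemma of_nat_card_adapted_basis:
  assumes "adapted_basis BU B"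
  shows "of_nat (card (B - BU)) = (of_nat (card D) :: 'a)"
proof -
  have B: "independent B" using assms by (simp add: adapted_basis_def)
  have "(\<Sum>b\<in>B - BU. representation B (id b) b) = (\<Sum>t\<in>D. \<phi> t (id (d t)))"
    by (rule quotient_trace_eq_sum_functionals[OF assms linear_id]) simp_all
  thus ?thesis by (simp add: representation_basis[OF B] dual)
qed

lemma of_nat_dim_diff:
  assumes "finite S" "V \<subseteq> span S"
  shows "of_nat (dim V - dim U) = (of_nat (card D) :: 'a)"
proof -
  obtain BU B where basis: "adapted_basis BU B" by (rule exists_adapted_basis[OF assms])
  hence B: "BU \<subseteq> B" "finite B" "independent B" "span B = V" "span BU = U"
    by (auto simp: adapted_basis_def)
  have "dim V = card B" "dim U = card BU"
    using dim_span_eq_card_independent[OF B(3)] B(4,5)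
      dim_span_eq_card_independent[OF independent_mono[OF B(3,1)]] by simp_all
  thus ?thesis
    using of_nat_card_adapted_basis[OF basis] B(1,2) by (simp add: card_Diff_subset finite_subset)
qed

end

lemma vector_space_fscale: "vector_space (fscale :: 'a::field \<Rightarrow> 'a fpoly \<Rightarrow> 'a fpoly)"
  by unfold_locales (auto simp: fun_eq_iff algebra_simps)

lemma quot_trace_eq_sum_functionals:
  fixes V U :: "'a::field fpoly set"
  assumes "dual_system fscale V U D d \<phi>"
    and "finite S" "V \<subseteq> module.span fscale S"
    and "Vector_Spaces.linear fscale fscale g" "\<And>v. v \<in> V \<Longrightarrow> g v \<in> V" "\<And>u. u \<in> U \<Longrightarrow> g u \<in> U"
  shows "quot_trace V U g = (\<Sum>t\<in>D. \<phi> t (g (d t)))"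
proof -
  interpret dual_system fscale V U D d \<phi> by (rule assms(1))
  have trace: "(\<Sum>b\<in>B - BU. representation B (g b) b) = (\<Sum>t\<in>D. \<phi> t (g (d t)))"
    if "adapted_basis BU B" for BU B
    by (rule quotient_trace_eq_sum_functionals[OF that assms(4-6)])
  obtain BU B where basis: "adapted_basis BU B" by (rule exists_adapted_basis[OF assms(2,3)])
  have "(SOME s. \<exists>BU B. adapted_basis BU B \<and> s = (\<Sum>b\<in>B - BU. representation B (g b) b)) =
      (\<Sum>t\<in>D. \<phi> t (g (d t)))"
    by (rule some_equality) (use basis trace[OF basis, symmetric] trace in blast)+
  thus ?thesis unfolding quot_trace_def adapted_basis_def conj_assoc .
qed

section \<open>Multilinear polynomials\<close>

definition multilin_words :: "nat \<Rightarrow> (nat + nat) list set" where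
  "multilin_words n = {w. multilin_word n w}"

lemma multilin_word_distinct: "multilin_word n w \<Longrightarrow> distinct w"
  by (auto simp: multilin_word_def distinct_map)

lemma finite_multilin_words: "finite (multilin_words n)"
proof (rule finite_subset)
  have letter: "l \<in> Inl ` {1..n} \<union> Inr ` {1..n}" if "letter_index l \<in> {1..n}" for l
    by (cases l) (use that in \<open>auto simp: letter_index_def\<close>)
  show "multilin_words n \<subseteq> {w. set w \<subseteq> Inl ` {1..n} \<union> Inr ` {1..n} \<and> length w = n}"
  proof (intro subsetI CollectI conjI)
    fix w assume "w \<in> multilin_words n"
    hence w: "distinct (map letter_index w)" "letter_index ` set w = {1..n}"
      by (simp_all add: multilin_words_def multilin_word_def)
    show "l \<in> Inl ` {1..n} \<union> Inr ` {1..n}" if "l \<in> set w" for l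
      using w(2) that by (intro letter) blast
    show "length w = n" using distinct_card[OF w(1)] w(2) by simp
  qed
  show "finite {w. set w \<subseteq> Inl ` {1..n} \<union> Inr ` {1..n} \<and> length w = n}"
    by (rule finite_lists_length_eq) simp
qed

lemma odd_indices_subset: "multilin_word n w \<Longrightarrow> set (odd_indices w) \<subseteq> {1..n}"
proof
  fix i assume "multilin_word n w" "i \<in> set (odd_indices w)"
  hence "letter_index (Inr i) \<in> {1..n}"
    unfolding multilin_word_def set_odd_indices set_map by blast
  thus "i \<in> {1..n}" by (simp add: letter_index_def)
qed

abbreviation relabel :: "(nat \<Rightarrow> nat) \<Rightarrow> (nat + nat) list \<Rightarrow> (nat + nat) list" where
  "relabel \<sigma> \<equiv> map (map_sum \<sigma> \<sigma>)"

lemma letter_index_map_sum: "letter_index (map_sum f f l) = f (letter_index l)"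
  by (cases l) (simp_all add: letter_index_def)

lemma multilin_word_relabel:
  assumes "multilin_word n w" "\<sigma> permutes {1..n}"
  shows "multilin_word n (relabel \<sigma> w)"
proof -
  have indices: "map letter_index (relabel \<sigma> w) = map \<sigma> (map letter_index w)"
    by (simp add: letter_index_map_sum)
  show ?thesis
    using assms(1) permutes_image[OF assms(2)]
      inj_on_subset[OF permutes_inj[OF assms(2)] subset_UNIV]
    unfolding multilin_word_def indices set_map[of \<sigma>] distinct_map[of \<sigma>] by simp
qed

lemma relabel_inv:
  assumes "\<sigma> permutes S"
  shows "relabel \<sigma> (relabel (inv_into UNIV \<sigma>) w) = w"
    and "relabel (inv_into UNIV \<sigma>) (relabel \<sigma> w) = w"
  by (simp_all add: map_sum.comp map_sum.id permutes_inv_o[OF assms])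

lemma bij_betw_multilin_words:
  assumes "\<sigma> permutes {1..n}"
  shows "bij_betw (relabel \<sigma>) (multilin_words n) (multilin_words n)"
proof (rule bij_betw_byWitness[where f' = "relabel (inv_into UNIV \<sigma>)"])
  show "relabel \<sigma> ` multilin_words n \<subseteq> multilin_words n"
    using multilin_word_relabel[OF _ assms] by (auto simp: multilin_words_def)
  show "relabel (inv_into UNIV \<sigma>) ` multilin_words n \<subseteq> multilin_words n"
    using multilin_word_relabel[OF _ permutes_inv[OF assms]] by (auto simp: multilin_words_def)
qed (simp_all add: relabel_inv[OF assms] del: map_map)

definition canonical_word :: "nat \<Rightarrow> nat set \<Rightarrow> (nat + nat) list" where
  "canonical_word n T = map (\<lambda>i. if i \<in> T then Inr i else Inl i) [1..<Suc n]"

lemma multilin_canonical_word: "multilin_word n (canonical_word n T)"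
proof -
  have "map letter_index (canonical_word n T) = [1..<Suc n]"
    unfolding canonical_word_def map_map by (rule map_idI) (simp add: letter_index_def)
  thus ?thesis unfolding multilin_word_def by (simp only: distinct_upt set_upt) auto
qed

lemma distinct_canonical_word: "distinct (canonical_word n T)"
  by (rule multilin_word_distinct[OF multilin_canonical_word])

lemma odd_indices_canonical_word:
  "odd_indices (canonical_word n T) = filter (\<lambda>i. i \<in> T) [1..<Suc n]"
proof -
  have "odd_indices (map (\<lambda>i. if i \<in> T then Inr i else Inl i) l) = filter (\<lambda>i. i \<in> T) l" for l
    by (induction l) simp_all
  thus ?thesis by (simp only: canonical_word_def)
qed

lemma sorted_odd_indices_canonical_word: "sorted_wrt (<) (odd_indices (canonical_word n T))"
  unfolding odd_indices_canonical_word by (intro sorted_wrt_filter sorted_wrt_upt)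

lemma set_odd_indices_canonical_word:
  "T \<subseteq> {1..n} \<Longrightarrow> set (odd_indices (canonical_word n T)) = T"
  unfolding odd_indices_canonical_word by (auto simp del: upt_Suc)

lemma set_canonical_word: "set (canonical_word n T) = Inl ` ({1..n} - T) \<union> Inr ` ({1..n} \<inter> T)"
  unfolding canonical_word_def by (auto simp del: upt_Suc)

lemma mset_canonical_word:
  assumes "multilin_word n w"
  shows "mset w = mset (canonical_word n (set (odd_indices w)))"
proof -
  let ?w = "canonical_word n (set (odd_indices w))"
  have index: "inj_on letter_index (set w)" "letter_index ` set w = {1..n}"
    using assms by (auto simp: multilin_word_def distinct_map)
  have "set w \<subseteq> set ?w"
  proof
    fix l assume l: "l \<in> set w"
    hence in_range: "letter_index l \<in> {1..n}" using index(2) by blast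
    show "l \<in> set ?w"
    proof (cases l)
      case (Inl i)
      hence "Inr i \<notin> set w"
        using inj_onD[OF index(1) _ l, of "Inr i"] by (auto simp: letter_index_def)
      thus ?thesis
        using Inl in_range by (simp add: set_canonical_word set_odd_indices letter_index_def)
    next
      case (Inr i)
      thus ?thesis
        using l in_range by (simp add: set_canonical_word set_odd_indices letter_index_def)
    qed
  qed
  moreover have "card (set v) = n" if "multilin_word n v" for v
  proof -
    have "inj_on letter_index (set v)" "letter_index ` set v = {1..n}"
      using that by (simp_all add: multilin_word_def distinct_map)
    thus ?thesis using card_image[of letter_index "set v"] by simp
  qed
  ultimately have "set w = set ?w"
    using assms multilin_canonical_word by (intro card_subset_eq) simp_all
  thus ?thesis
    using multilin_word_distinct[OF assms] distinct_canonical_word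
    by (simp add: set_eq_iff_mset_eq_distinct)
qed

definition words_of_type :: "nat \<Rightarrow> nat set \<Rightarrow> (nat + nat) list set" where
  "words_of_type n T = {w \<in> multilin_words n. set (odd_indices w) = T}"

text \<open>Modulo the graded identities, the component of \<open>f\<close> with odd variables \<open>T\<close> is
  \<open>signed_sum n T f\<close> times the canonical monomial.\<close>

definition signed_sum :: "nat \<Rightarrow> nat set \<Rightarrow> 'a::field fpoly \<Rightarrow> 'a" where
  "signed_sum n T f = (\<Sum>w\<in>words_of_type n T. word_sign w * f w)"

lemma fpoly_eval_eq_sum_multilin_words:
  assumes "f \<in> P_gr n"
  shows "fpoly_eval f ys zs C = (\<Sum>w\<in>multilin_words n. f w * word_eval ys zs w C)"
  unfolding fpoly_eval_def word_eval_def
  by (rule sum.mono_neutral_left[OF finite_multilin_words])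
    (use assms in \<open>auto simp: P_gr_def multilin_words_def\<close>)

lemma fpoly_eval_eq_sum_canonical:
  fixes ys zs :: "nat \<Rightarrow> 'a::field grass"
  assumes "graded_eval_ok ys zs" "f \<in> P_gr n"
  shows "fpoly_eval f ys zs C =
    (\<Sum>T\<in>Pow {1..n}. signed_sum n T f * word_eval ys zs (canonical_word n T) C)"
proof -
  have word: "word_eval ys zs w C = word_sign w * word_eval ys zs (canonical_word n T) C"
    if "w \<in> words_of_type n T" for w T
    using that mset_canonical_word[of n w]
      word_eval_eq_word_sign_scale[OF assms(1) _ sorted_odd_indices_canonical_word, of w n T]
    by (simp add: words_of_type_def multilin_words_def grass_scale_def)
  have "fpoly_eval f ys zs C =
      (\<Sum>T\<in>Pow {1..n}. \<Sum>w\<in>words_of_type n T. f w * word_eval ys zs w C)"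
    unfolding fpoly_eval_eq_sum_multilin_words[OF assms(2)] words_of_type_def
    using finite_multilin_words odd_indices_subset
    by (intro sum.group[symmetric]) (auto simp: multilin_words_def)
  also have "\<dots> = (\<Sum>T\<in>Pow {1..n}. signed_sum n T f * word_eval ys zs (canonical_word n T) C)"
    unfolding signed_sum_def sum_distrib_right by (intro sum.cong refl) (simp add: word)
  finally show ?thesis .
qed

definition separating_even :: "nat set \<Rightarrow> nat \<Rightarrow> 'a::field grass" where
  "separating_even T i = (if i \<in> T then (\<lambda>_. 0) else grass_one)"

definition separating_odd :: "nat set \<Rightarrow> nat \<Rightarrow> 'a::field grass" where
  "separating_odd T i = (if i \<in> T then grass_basis {i} else (\<lambda>_. 0))"

lemma graded_eval_ok_separating: "graded_eval_ok (separating_even T) (separating_odd T)"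
  by (simp add: graded_eval_ok_def separating_even_def separating_odd_def grass_even_eq_component
      grass_odd_eq_component grass_one_component grass_generator_component[simplified])

lemma word_eval_separating_canonical:
  assumes "T \<subseteq> {1..n}" "T' \<subseteq> {1..n}"
  shows "word_eval (separating_even T) (separating_odd T) (canonical_word n T') =
    (if T' = T then grass_basis T else (\<lambda>_. 0))"
proof (cases "T' = T")
  case True
  have "word_eval (separating_even T) (separating_odd T) (canonical_word n T) =
      standard_eval (canonical_word n T)"
    by (rule word_eval_cong)
      (auto simp: set_canonical_word separating_even_def separating_odd_def)
  thus ?thesis
    using True assms
    by (simp add: word_eval_sorted sorted_odd_indices_canonical_word set_odd_indices_canonical_word)
next
  case False
  then obtain i where i: "i \<in> set [1..<Suc n]" "i \<in> T' \<longleftrightarrow> i \<notin> T" using assms by force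
  let ?l = "if i \<in> T' then Inr i else Inl i"
  have "?l \<in> set (canonical_word n T')" using i(1) by (simp add: canonical_word_def del: upt_Suc)
  moreover have zero: "case_sum (separating_even T) (separating_odd T) ?l = (\<lambda>_. 0)"
    using i(2) by (simp add: separating_even_def separating_odd_def)
  ultimately have "(\<lambda>_. 0) \<in>
      set (map (case_sum (separating_even T) (separating_odd T)) (canonical_word n T'))"
    unfolding set_map zero[symmetric] by (intro imageI)
  from grass_prod_eq_zero[OF this] show ?thesis using False by (simp add: word_eval_def)
qed

lemma fpoly_eval_separating:
  assumes "T \<subseteq> {1..n}" "f \<in> P_gr n"
  shows "fpoly_eval f (separating_even T) (separating_odd T) =
    grass_scale (signed_sum n T f) (grass_basis T)"
proof
  fix C
  have "fpoly_eval f (separating_even T) (separating_odd T) C =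
      (\<Sum>T'\<in>Pow {1..n}. if T' = T then signed_sum n T f * grass_basis T C else 0)"
    unfolding fpoly_eval_eq_sum_canonical[OF graded_eval_ok_separating assms(2)]
    using assms(1) by (intro sum.cong) (auto simp: word_eval_separating_canonical)
  thus "fpoly_eval f (separating_even T) (separating_odd T) C =
      grass_scale (signed_sum n T f) (grass_basis T) C"
    using assms(1) by (simp add: grass_scale_def)
qed

section \<open>Identities and central polynomials\<close>

definition signed_kernel :: "nat \<Rightarrow> nat set \<Rightarrow> 'a::field fpoly set" where
  "signed_kernel n I = {f \<in> P_gr n. \<forall>T. T \<subseteq> {1..n} \<and> card T \<in> I \<longrightarrow> signed_sum n T f = 0}"

lemma finite_support_P_gr: "f \<in> P_gr n \<Longrightarrow> finite {w. f w \<noteq> 0}"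
  by (rule finite_subset[OF _ finite_multilin_words[of n]]) (auto simp: P_gr_def multilin_words_def)

lemma P_gr_eq_signed_kernel: "P_gr n = signed_kernel n {}"
  by (simp add: signed_kernel_def)

lemma signed_sum_eq_0_if_identity:
  assumes "f \<in> P_gr n" "f \<in> Id_gr" "T \<subseteq> {1..n}"
  shows "signed_sum n T f = (0 :: 'a::field)"
proof -
  have "fpoly_eval f (separating_even T) (separating_odd T) = (\<lambda>_. 0)"
    using assms(2) graded_eval_ok_separating[of T] unfolding Id_gr_def by blast
  hence "grass_scale (signed_sum n T f) (grass_basis T) T = 0"
    using assms(1,3) by (simp add: fpoly_eval_separating)
  thus ?thesis by (simp add: grass_scale_def)
qed

lemma signed_sum_odd_eq_0_if_central:
  assumes "f \<in> P_gr n" "f \<in> C_gr" "T \<subseteq> {1..n}" "odd (card T)"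
  shows "signed_sum n T f = (0 :: 'a::field_char_0)"
proof -
  have "fpoly_eval f (separating_even T) (separating_odd T) \<in> grass_center"
    using assms(2) graded_eval_ok_separating[of T] unfolding C_gr_def by blast
  hence "grass_scale (signed_sum n T f) (grass_basis T) \<in> grass_center"
    using assms(1,3) by (simp add: fpoly_eval_separating)
  moreover have "finite T" using assms(3) by (rule finite_subset) simp
  ultimately show ?thesis using assms(4) by (intro scaled_odd_basis_central_imp_zero)
qed

lemma fpoly_eval_central:
  assumes ok: "graded_eval_ok ys zs" and P: "f \<in> P_gr n"
    and odd: "\<And>T. T \<subseteq> {1..n} \<Longrightarrow> odd (card T) \<Longrightarrow> signed_sum n T f = 0"
  shows "fpoly_eval f ys zs \<in> (grass_center :: 'a::field grass set)"
proof -
  let ?t = "\<lambda>T. grass_scale (signed_sum n T f) (word_eval ys zs (canonical_word n T))"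
  have "?t T \<in> grass_component 0" if T: "T \<in> Pow {1..n}" for T
  proof (cases "odd (card T)")
    case True
    thus ?thesis using T by (simp add: odd)
  next
    case False
    have "length (odd_indices (canonical_word n T)) = card T"
      using T distinct_card[OF distinct_odd_indices[OF distinct_canonical_word], of n T]
      by (simp add: set_odd_indices_canonical_word)
    hence "grass_component (length (odd_indices (canonical_word n T))) =
        (grass_component 0 :: 'a grass set)"
      using False by (intro grass_component_cong_even) simp
    thus ?thesis using grass_scale_component[OF word_eval_component[OF ok]] by blast
  qed
  hence "(\<lambda>C. \<Sum>T\<in>Pow {1..n}. ?t T C) \<in> grass_center"
    by (intro grass_component_0_center grass_sum_component)
  also have "(\<lambda>C. \<Sum>T\<in>Pow {1..n}. ?t T C) = fpoly_eval f ys zs"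
    by (simp add: fpoly_eval_eq_sum_canonical[OF ok P] grass_scale_def fun_eq_iff)
  finally show ?thesis .
qed

abbreviation odd_upto :: "nat \<Rightarrow> nat set" where
  "odd_upto n \<equiv> {i. 1 \<le> i \<and> i \<le> n \<and> odd i}"

abbreviation even_upto :: "nat \<Rightarrow> nat set" where
  "even_upto n \<equiv> {i. i \<le> n \<and> even i}"

lemma odd_upto_Int_even_upto: "odd_upto n \<inter> even_upto n = {}"
  and odd_upto_Un_even_upto: "odd_upto n \<union> even_upto n = {..n}"
  by (auto simp: Suc_le_eq odd_pos)

lemma card_subset_atLeastAtMost: "T \<subseteq> {1..n} \<Longrightarrow> card T \<le> n"
  using card_mono[of "{1..n}" T] by simp

lemma P_gr_Int_C_gr:
  assumes "n \<ge> 1"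
  shows "P_gr n \<inter> C_gr = (signed_kernel n (odd_upto n) :: 'a::field_char_0 fpoly set)"
proof (intro equalityI subsetI)
  fix f :: "'a fpoly" assume "f \<in> P_gr n \<inter> C_gr"
  thus "f \<in> signed_kernel n (odd_upto n)"
    by (simp add: signed_kernel_def signed_sum_odd_eq_0_if_central)
next
  fix f :: "'a fpoly" assume f: "f \<in> signed_kernel n (odd_upto n)"
  hence P: "f \<in> P_gr n" by (simp add: signed_kernel_def)
  have "signed_sum n T f = 0" if "T \<subseteq> {1..n}" "odd (card T)" for T
    using f that odd_pos[OF that(2)]
    by (simp add: signed_kernel_def Suc_le_eq card_subset_atLeastAtMost)
  hence "fpoly_eval f ys zs \<in> grass_center" if "graded_eval_ok ys zs" for ys zs
    using that by (intro fpoly_eval_central[OF _ P])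
  moreover have "f [] = 0" using P assms by (auto simp: P_gr_def multilin_word_def)
  ultimately show "f \<in> P_gr n \<inter> C_gr" using P by (simp add: C_gr_def finite_support_P_gr)
qed

lemma P_gr_Int_Id_gr:
  "P_gr n \<inter> Id_gr = (signed_kernel n (odd_upto n \<union> even_upto n) :: 'a::field fpoly set)"
  unfolding odd_upto_Un_even_upto
proof (intro equalityI subsetI)
  fix f :: "'a fpoly" assume "f \<in> P_gr n \<inter> Id_gr"
  thus "f \<in> signed_kernel n {..n}" by (simp add: signed_kernel_def signed_sum_eq_0_if_identity)
next
  fix f :: "'a fpoly" assume "f \<in> signed_kernel n {..n}"
  hence "f \<in> P_gr n" "\<And>T. T \<in> Pow {1..n} \<Longrightarrow> signed_sum n T f = 0"
    by (simp_all add: signed_kernel_def card_subset_atLeastAtMost)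
  thus "f \<in> P_gr n \<inter> Id_gr"
    by (simp add: Id_gr_def finite_support_P_gr fpoly_eval_eq_sum_canonical fun_eq_iff)
qed

definition word_monomial :: "(nat + nat) list \<Rightarrow> 'a::field fpoly" where
  "word_monomial v = (\<lambda>w. of_bool (w = v))"

lemma word_monomial_P_gr: "multilin_word n w \<Longrightarrow> word_monomial w \<in> P_gr n"
  by (simp add: P_gr_def word_monomial_def)

lemma sum_fun_apply: "(\<Sum>i\<in>S. F i) x = (\<Sum>i\<in>S. F i x :: 'b::comm_monoid_add)"
  by (induction S rule: infinite_finite_induct) auto

lemma P_gr_subset_span:
  "P_gr n \<subseteq> module.span fscale (word_monomial ` multilin_words n :: 'a::field fpoly set)"
proof
  interpret vector_space "fscale :: 'a \<Rightarrow> 'a fpoly \<Rightarrow> 'a fpoly" by (rule vector_space_fscale)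
  fix f :: "'a fpoly" assume f: "f \<in> P_gr n"
  have "f = (\<Sum>v\<in>multilin_words n. fscale (f v) (word_monomial v))"
  proof
    fix w
    have "(\<Sum>v\<in>multilin_words n. fscale (f v) (word_monomial v)) w =
        (\<Sum>v\<in>multilin_words n. if w = v then f v else 0)"
      unfolding sum_fun_apply by (intro sum.cong) (auto simp: word_monomial_def)
    also have "\<dots> = f w"
      using f finite_multilin_words[of n] by (auto simp: P_gr_def multilin_words_def)
    finally show "f w = (\<Sum>v\<in>multilin_words n. fscale (f v) (word_monomial v)) w" ..
  qed
  also have "\<dots> \<in> span (word_monomial ` multilin_words n)"
    by (intro span_sum span_scale span_base imageI)
  finally show "f \<in> span (word_monomial ` multilin_words n)" .
qed

lemma signed_sum_add: "signed_sum n T (f + g) = signed_sum n T f + signed_sum n T g"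
  and signed_sum_scale: "signed_sum n T (fscale c f) = c * signed_sum n T f"
  and signed_sum_zero: "signed_sum n T 0 = 0"
  by (simp_all add: signed_sum_def algebra_simps sum.distrib sum_distrib_left)

lemma linear_signed_sum: "Vector_Spaces.linear fscale (*) (signed_sum n T :: 'a::field fpoly \<Rightarrow> 'a)"
  unfolding Vector_Spaces.linear_iff
proof (intro conjI allI vector_space_fscale)
  show "vector_space ((*) :: 'a \<Rightarrow> 'a \<Rightarrow> 'a)"
    by unfold_locales (simp_all add: algebra_simps)
qed (simp_all add: signed_sum_add signed_sum_scale)

lemma signed_sum_word_monomial:
  assumes "multilin_word n w"
  shows "signed_sum n T (word_monomial w) =
    (if set (odd_indices w) = T then word_sign w else (0 :: 'a::field))"
proof -
  have "signed_sum n T (word_monomial w) =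
      (\<Sum>v\<in>words_of_type n T. if v = w then word_sign w else (0 :: 'a))"
    unfolding signed_sum_def word_monomial_def by (intro sum.cong) auto
  moreover have "w \<in> words_of_type n T \<longleftrightarrow> set (odd_indices w) = T"
    using assms by (simp add: words_of_type_def multilin_words_def)
  moreover have "finite (words_of_type n T)"
    using finite_multilin_words by (simp add: words_of_type_def)
  ultimately show ?thesis by simp
qed

lemma signed_sum_canonical:
  assumes "T' \<subseteq> {1..n}"
  shows "signed_sum n T (word_monomial (canonical_word n T')) = (of_bool (T = T') :: 'a::field)"
proof -
  have "word_sign (canonical_word n T') = (1 :: 'a)"
    by (rule word_sign_sorted[OF sorted_odd_indices_canonical_word])
  thus ?thesis
    using assms
    by (auto simp: signed_sum_word_monomial multilin_canonical_word set_odd_indices_canonical_word)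
qed

definition subsets_of_card :: "nat \<Rightarrow> nat set \<Rightarrow> nat set set" where
  "subsets_of_card n I = {T. T \<subseteq> {1..n} \<and> card T \<in> I}"

lemma finite_subsets_of_card: "finite (subsets_of_card n I)"
  by (rule finite_subset[of _ "Pow {1..n}"]) (auto simp: subsets_of_card_def)

lemma P_gr_add: "f \<in> P_gr n \<Longrightarrow> g \<in> P_gr n \<Longrightarrow> f + g \<in> P_gr n"
  unfolding P_gr_def mem_Collect_eq plus_fun_apply by (metis add_0)

lemma subspace_signed_kernel: "module.subspace fscale (signed_kernel n I :: 'a::field fpoly set)"
proof -
  interpret vector_space "fscale :: 'a \<Rightarrow> 'a fpoly \<Rightarrow> 'a fpoly" by (rule vector_space_fscale)
  show ?thesis
    unfolding subspace_def
  proof (intro conjI ballI allI)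
    show "0 \<in> (signed_kernel n I :: 'a fpoly set)"
      by (simp add: signed_kernel_def P_gr_def signed_sum_zero)
  next
    fix f g :: "'a fpoly" assume "f \<in> signed_kernel n I" "g \<in> signed_kernel n I"
    thus "f + g \<in> signed_kernel n I"
      by (simp add: signed_kernel_def P_gr_add signed_sum_add)
  next
    fix c and f :: "'a fpoly" assume "f \<in> signed_kernel n I"
    thus "fscale c f \<in> signed_kernel n I"
      by (simp add: signed_kernel_def P_gr_def signed_sum_scale)
  qed
qed

lemma dual_system_signed_sum:
  assumes "J \<inter> I = {}"
  shows "dual_system fscale (signed_kernel n J) (signed_kernel n (J \<union> I) :: 'a::field fpoly set)
    (subsets_of_card n I) (\<lambda>T. word_monomial (canonical_word n T)) (signed_sum n)"
proof (intro dual_system.intro dual_system_axioms.intro vector_space_fscale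
    subspace_signed_kernel linear_signed_sum)
  show "finite (subsets_of_card n I)" by (rule finite_subsets_of_card)
  show "signed_kernel n (J \<union> I) =
      {f \<in> signed_kernel n J. \<forall>T\<in>subsets_of_card n I. signed_sum n T f = (0 :: 'a)}"
    unfolding signed_kernel_def subsets_of_card_def by blast
  fix T T' assume T: "T \<in> subsets_of_card n I"
  have "T \<noteq> T''" if "card T'' \<in> J" for T''
    using that T assms by (auto simp: subsets_of_card_def)
  thus "word_monomial (canonical_word n T) \<in> (signed_kernel n J :: 'a fpoly set)"
    using T by (auto simp: signed_kernel_def subsets_of_card_def signed_sum_canonical
        word_monomial_P_gr[OF multilin_canonical_word])
  assume "T' \<in> subsets_of_card n I"
  thus "signed_sum n T (word_monomial (canonical_word n T')) = (of_bool (T = T') :: 'a)"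
    by (simp add: signed_sum_canonical subsets_of_card_def)
qed

lemma signed_kernel_subset_span:
  "signed_kernel n I \<subseteq> module.span fscale (word_monomial ` multilin_words n :: 'a::field fpoly set)"
  using P_gr_subset_span[of n] by (auto simp: signed_kernel_def)

lemma sum_subsets_of_card:
  assumes "finite I"
  shows "(\<Sum>T\<in>subsets_of_card n I. h T) = (\<Sum>i\<in>I. \<Sum>T | T \<subseteq> {1..n} \<and> card T = i. h T)"
proof -
  have "(\<Sum>i\<in>I. sum h {T \<in> subsets_of_card n I. card T = i}) = sum h (subsets_of_card n I)"
    by (rule sum.group) (use assms finite_subsets_of_card in \<open>auto simp: subsets_of_card_def\<close>)
  moreover have "{T \<in> subsets_of_card n I. card T = i} = {T. T \<subseteq> {1..n} \<and> card T = i}"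
    if "i \<in> I" for i
    using that by (auto simp: subsets_of_card_def)
  ultimately show ?thesis by simp
qed

lemma fdim_signed_kernel_diff:
  assumes "J \<inter> I = {}" "finite I"
  shows "fdim (signed_kernel n J :: 'a::field_char_0 fpoly set) -
      fdim (signed_kernel n (J \<union> I) :: 'a fpoly set) = (\<Sum>i\<in>I. n choose i)"
proof -
  have "of_nat (fdim (signed_kernel n J :: 'a fpoly set) -
        fdim (signed_kernel n (J \<union> I) :: 'a fpoly set)) =
      (of_nat (card (subsets_of_card n I)) :: 'a)"
    unfolding fdim_def
    by (rule dual_system.of_nat_dim_diff[OF dual_system_signed_sum[OF assms(1)]
          finite_imageI[OF finite_multilin_words] signed_kernel_subset_span])
  moreover have "card (subsets_of_card n I) = (\<Sum>i\<in>I. n choose i)"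
    unfolding card_eq_sum sum_subsets_of_card[OF assms(2)]
    by (simp flip: card_eq_sum add: n_subsets)
  ultimately show ?thesis by (simp only: of_nat_eq_iff)
qed

section \<open>The action of the wreath product\<close>

lemma prod_list_odd_letters:
  "prod_list (map (case_sum (\<lambda>_. 1) a) w) = prod_list (map a (odd_indices w))"
proof (induction w)
  case (Cons l w)
  thus ?case by (cases l) simp_all
qed simp

lemma wr_act_relabel:
  assumes "\<sigma> permutes S"
  shows "wr_act a \<sigma> f (relabel \<sigma> w) = prod_list (map (a \<circ> \<sigma>) (odd_indices w)) * f w"
  unfolding wr_act_def prod_list_odd_letters relabel_inv[OF assms] by simp

lemma wr_act_P_gr:
  assumes "\<sigma> permutes {1..n}" "f \<in> P_gr n"
  shows "wr_act a \<sigma> f \<in> P_gr n"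
  unfolding P_gr_def
proof (intro CollectI allI impI)
  fix w assume nonzero: "wr_act a \<sigma> f w \<noteq> 0"
  let ?v = "relabel (inv_into UNIV \<sigma>) w"
  have w: "w = relabel \<sigma> ?v" by (simp only: relabel_inv[OF assms(1)])
  have "f ?v \<noteq> 0" using nonzero unfolding wr_act_def by auto
  hence "multilin_word n ?v" using assms(2) unfolding P_gr_def by blast
  thus "multilin_word n w" by (subst w) (rule multilin_word_relabel[OF _ assms(1)])
qed

lemma wr_act_word_monomial:
  assumes "\<sigma> permutes S"
  shows "wr_act a \<sigma> (word_monomial w) =
    fscale (prod_list (map (a \<circ> \<sigma>) (odd_indices w))) (word_monomial (relabel \<sigma> w))"
proof
  fix v
  define u where "u = relabel (inv_into UNIV \<sigma>) v"
  have v: "v = relabel \<sigma> u" by (simp only: u_def relabel_inv[OF assms])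
  have "relabel \<sigma> u = relabel \<sigma> w \<longleftrightarrow> u = w"
    using relabel_inv(2)[OF assms] by metis
  thus "wr_act a \<sigma> (word_monomial w) v =
      prod_list (map (a \<circ> \<sigma>) (odd_indices w)) * word_monomial (relabel \<sigma> w) v"
    unfolding v wr_act_relabel[OF assms] word_monomial_def by (cases "u = w") simp_all
qed

lemma word_eval_scale_odd:
  "word_eval ys (\<lambda>i. grass_scale (c i) (zs i)) w =
    grass_scale (prod_list (map c (odd_indices w))) (word_eval ys zs w)"
proof (induction w)
  case (Cons l w)
  thus ?case by (cases l) (simp_all add: mult.commute)
qed simp

lemma fpoly_eval_wr_act:
  assumes "\<sigma> permutes {1..n}" "f \<in> P_gr n"
  shows "fpoly_eval (wr_act a \<sigma> f) ys zs =
    fpoly_eval f (ys \<circ> \<sigma>) (\<lambda>i. grass_scale (a (\<sigma> i)) (zs (\<sigma> i)))"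
proof
  fix C
  have scale: "word_eval (ys \<circ> \<sigma>) (\<lambda>i. grass_scale (a (\<sigma> i)) (zs (\<sigma> i))) w =
      grass_scale (prod_list (map (a \<circ> \<sigma>) (odd_indices w))) (word_eval (ys \<circ> \<sigma>) (zs \<circ> \<sigma>) w)" for w
    using word_eval_scale_odd[of "ys \<circ> \<sigma>" "a \<circ> \<sigma>" "zs \<circ> \<sigma>" w] by (simp add: comp_def)
  have "fpoly_eval (wr_act a \<sigma> f) ys zs C =
      (\<Sum>w\<in>multilin_words n. wr_act a \<sigma> f (relabel \<sigma> w) *
        word_eval ys zs (relabel \<sigma> w) C)"
    unfolding fpoly_eval_eq_sum_multilin_words[OF wr_act_P_gr[OF assms]]
    by (rule sum.reindex_bij_betw[OF bij_betw_multilin_words[OF assms(1)], symmetric])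
  also have "\<dots> = fpoly_eval f (ys \<circ> \<sigma>) (\<lambda>i. grass_scale (a (\<sigma> i)) (zs (\<sigma> i))) C"
    unfolding fpoly_eval_eq_sum_multilin_words[OF assms(2)] wr_act_relabel[OF assms(1)]
      word_eval_map_sum scale
    by (simp add: grass_scale_def ac_simps)
  finally show "fpoly_eval (wr_act a \<sigma> f) ys zs C =
      fpoly_eval f (ys \<circ> \<sigma>) (\<lambda>i. grass_scale (a (\<sigma> i)) (zs (\<sigma> i))) C" .
qed

lemma graded_eval_ok_scale:
  assumes "graded_eval_ok ys zs"
  shows "graded_eval_ok (ys \<circ> \<sigma>) (\<lambda>i. grass_scale (c i) (zs (\<sigma> i)))"
  using assms by (simp add: graded_eval_ok_def grass_odd_eq_component grass_scale_component)

lemma wr_act_Id_gr: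
  assumes "\<sigma> permutes {1..n}" "f \<in> P_gr n \<inter> Id_gr"
  shows "wr_act a \<sigma> f \<in> P_gr n \<inter> Id_gr"
proof -
  have P_gr: "wr_act a \<sigma> f \<in> P_gr n" using assms by (simp add: wr_act_P_gr)
  have f: "f \<in> P_gr n" "f \<in> Id_gr" using assms(2) by blast+
  have "fpoly_eval (wr_act a \<sigma> f) ys zs = (\<lambda>_. 0)" if "graded_eval_ok ys zs" for ys zs
    unfolding fpoly_eval_wr_act[OF assms(1) f(1)]
    using f(2) graded_eval_ok_scale[OF that, of \<sigma> "\<lambda>i. a (\<sigma> i)"] unfolding Id_gr_def by blast
  thus ?thesis
    using P_gr finite_support_P_gr[OF P_gr] unfolding Id_gr_def by blast
qed

lemma wr_act_C_gr:
  assumes "\<sigma> permutes {1..n}" "f \<in> P_gr n \<inter> C_gr"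
  shows "wr_act a \<sigma> f \<in> P_gr n \<inter> C_gr"
proof -
  have P_gr: "wr_act a \<sigma> f \<in> P_gr n" using assms by (simp add: wr_act_P_gr)
  have f: "f \<in> P_gr n" "f \<in> C_gr" using assms(2) by blast+
  have "fpoly_eval (wr_act a \<sigma> f) ys zs \<in> grass_center" if "graded_eval_ok ys zs" for ys zs
    unfolding fpoly_eval_wr_act[OF assms(1) f(1)]
    using f(2) graded_eval_ok_scale[OF that, of \<sigma> "\<lambda>i. a (\<sigma> i)"] unfolding C_gr_def by blast
  moreover have "wr_act a \<sigma> f [] = 0" using f(2) by (simp add: wr_act_def C_gr_def)
  ultimately show ?thesis
    using P_gr finite_support_P_gr[OF P_gr] unfolding C_gr_def by blast
qed

lemma linear_wr_act: "Vector_Spaces.linear fscale fscale (wr_act a \<sigma> :: 'a::field fpoly \<Rightarrow> 'a fpoly)"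
  unfolding Vector_Spaces.linear_iff
  by (intro conjI allI vector_space_fscale) (simp_all add: wr_act_def fun_eq_iff algebra_simps)

definition twisted_sign :: "(nat \<Rightarrow> 'a::field) \<Rightarrow> (nat \<Rightarrow> nat) \<Rightarrow> nat set \<Rightarrow> 'a" where
  "twisted_sign a \<sigma> T = (if \<sigma> ` T = T then of_int (sign_on T \<sigma>) * (\<Prod>j\<in>T. a j) else 0)"

lemma signed_sum_wr_act_canonical:
  fixes a :: "nat \<Rightarrow> 'a::field"
  assumes \<sigma>: "\<sigma> permutes {1..n}" and T: "T \<subseteq> {1..n}"
  shows "signed_sum n T (wr_act a \<sigma> (word_monomial (canonical_word n T))) = twisted_sign a \<sigma> T"
proof -
  let ?w = "canonical_word n T"
  let ?c = "prod_list (map (a \<circ> \<sigma>) (odd_indices ?w))"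
  have odd_w: "set (odd_indices ?w) = T" "distinct (odd_indices ?w)"
    by (simp_all add: set_odd_indices_canonical_word[OF T] distinct_odd_indices
        distinct_canonical_word)
  have "signed_sum n T (wr_act a \<sigma> (word_monomial ?w)) =
      ?c * signed_sum n T (word_monomial (relabel \<sigma> ?w))"
    by (simp only: wr_act_word_monomial[OF \<sigma>] signed_sum_scale)
  also have "signed_sum n T (word_monomial (relabel \<sigma> ?w)) =
      (if \<sigma> ` T = T then word_sign (relabel \<sigma> ?w) else 0)"
    by (simp add: signed_sum_word_monomial multilin_word_relabel[OF multilin_canonical_word \<sigma>]
        odd_w)
  finally have eval: "signed_sum n T (wr_act a \<sigma> (word_monomial ?w)) =
      ?c * (if \<sigma> ` T = T then word_sign (relabel \<sigma> ?w) else 0)" .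
  show ?thesis
  proof (cases "\<sigma> ` T = T")
    case True
    hence bij: "bij_betw \<sigma> T T"
      using inj_on_subset[OF permutes_inj[OF \<sigma>]] by (simp add: bij_betw_def)
    have "?c = (\<Prod>j\<in>T. a (\<sigma> j))"
      using prod.distinct_set_conv_list[OF odd_w(2), of "a \<circ> \<sigma>"] by (simp add: odd_w(1))
    also have "\<dots> = (\<Prod>j\<in>T. a j)" by (rule prod.reindex_bij_betw[OF bij])
    finally have "?c = (\<Prod>j\<in>T. a j)" .
    moreover have "word_sign (relabel \<sigma> ?w) = (of_int (sign_on T \<sigma>) :: 'a)"
      using bij by (simp add: word_sign_map_sum distinct_canonical_word
          sorted_odd_indices_canonical_word odd_w(1))
    ultimately show ?thesis using True by (simp add: eval twisted_sign_def)
  qed (simp add: eval twisted_sign_def)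
qed

lemma wr_char_row_column:
  fixes a :: "nat \<Rightarrow> 'a::field_char_0"
  assumes \<sigma>: "\<sigma> permutes {1..n}"
  shows "wr_char (row_part (n - i)) (col_part i) n a \<sigma> =
    (\<Sum>T | T \<subseteq> {1..n} \<and> card T = i. twisted_sign a \<sigma> T)"
proof -
  have perm: "permutation \<sigma>" by (rule permutes_imp_permutation[OF finite_atLeastAtMost \<sigma>])
  have "sym_char (row_part (n - i)) ({1..n} - T) \<sigma> * sym_char (col_part i) T \<sigma> = sign_on T \<sigma>"
    if T: "T \<subseteq> {1..n}" "card T = i" "\<sigma> ` T = T" for T
  proof -
    have "finite T" using T(1) finite_subset by blast
    moreover from this have "card ({1..n} - T) = n - i" using T by (simp add: card_Diff_subset)
    moreover have "\<sigma> ` ({1..n} - T) = {1..n} - T"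
      by (rule image_Diff_invariant[OF perm permutes_image[OF \<sigma>] T(3)])
    ultimately show ?thesis
      using sym_char_row[of "{1..n} - T" \<sigma>] sym_char_column[OF _ perm T(3)] T(2) by simp
  qed
  hence "wr_char (row_part (n - i)) (col_part i) n a \<sigma> =
      (\<Sum>T | T \<subseteq> {1..n} \<and> card T = i \<and> \<sigma> ` T = T. of_int (sign_on T \<sigma>) * (\<Prod>j\<in>T. a j))"
    unfolding wr_char_def by (intro sum.cong) (auto simp: col_part_def sum_list_replicate)
  also have "\<dots> = (\<Sum>T | T \<subseteq> {1..n} \<and> card T = i. twisted_sign a \<sigma> T)"
    by (rule sum.mono_neutral_cong_left) (auto simp: twisted_sign_def split: if_splits)
  finally show ?thesis .
qed

lemma quot_trace_wr_act:
  fixes a :: "nat \<Rightarrow> 'a::field_char_0"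
  assumes "J \<inter> I = {}" "finite I" and \<sigma>: "\<sigma> permutes {1..n}"
    and "\<And>f. f \<in> signed_kernel n J \<Longrightarrow> wr_act a \<sigma> f \<in> signed_kernel n J"
    and "\<And>f. f \<in> signed_kernel n (J \<union> I) \<Longrightarrow> wr_act a \<sigma> f \<in> signed_kernel n (J \<union> I)"
  shows "quot_trace (signed_kernel n J) (signed_kernel n (J \<union> I)) (wr_act a \<sigma>) =
    (\<Sum>i\<in>I. wr_char (row_part (n - i)) (col_part i) n a \<sigma>)"
proof -
  have "quot_trace (signed_kernel n J) (signed_kernel n (J \<union> I)) (wr_act a \<sigma>) =
      (\<Sum>T\<in>subsets_of_card n I. signed_sum n T (wr_act a \<sigma> (word_monomial (canonical_word n T))))"
    by (rule quot_trace_eq_sum_functionals[OF dual_system_signed_sum[OF assms(1)]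
          finite_imageI[OF finite_multilin_words] signed_kernel_subset_span linear_wr_act
          assms(4,5)])
  also have "\<dots> = (\<Sum>T\<in>subsets_of_card n I. twisted_sign a \<sigma> T)"
    by (rule sum.cong[OF refl]) (simp add: subsets_of_card_def signed_sum_wr_act_canonical[OF \<sigma>])
  also have "\<dots> = (\<Sum>i\<in>I. wr_char (row_part (n - i)) (col_part i) n a \<sigma>)"
    by (simp only: sum_subsets_of_card[OF assms(2)] wr_char_row_column[OF \<sigma>])
  finally show ?thesis .
qed

section \<open>Codimensions and cocharacters\<close>

lemma c_gr_z_eq:
  assumes "n \<ge> 1"
  shows "c_gr_z (F :: 'a::field_char_0 itself) n = (\<Sum>i\<in>odd_upto n. n choose i)"
  using fdim_signed_kernel_diff[of "{}" "odd_upto n" n, where ?'a = 'a]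
  unfolding c_gr_z_def P_gr_Int_C_gr[OF assms] unfolding P_gr_eq_signed_kernel by simp

lemma delta_gr_eq:
  assumes "n \<ge> 1"
  shows "delta_gr (F :: 'a::field_char_0 itself) n = (\<Sum>i\<in>even_upto n. n choose i)"
  unfolding delta_gr_def P_gr_Int_C_gr[OF assms] P_gr_Int_Id_gr
  by (rule fdim_signed_kernel_diff[OF odd_upto_Int_even_upto]) simp

lemma chi_gr_z_eq:
  fixes a :: "nat \<Rightarrow> 'a::field_char_0"
  assumes "n \<ge> 1" and \<sigma>: "\<sigma> permutes {1..n}"
  shows "chi_gr_z n a \<sigma> = (\<Sum>i\<in>odd_upto n. wr_char (row_part (n - i)) (col_part i) n a \<sigma>)"
proof -
  have P: "P_gr n = (signed_kernel n {} :: 'a fpoly set)" by (rule P_gr_eq_signed_kernel)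
  have C: "P_gr n \<inter> C_gr = (signed_kernel n ({} \<union> odd_upto n) :: 'a fpoly set)"
    by (simp only: P_gr_Int_C_gr[OF assms(1)] Un_empty_left)
  show ?thesis
    unfolding chi_gr_z_def C unfolding P
    by (rule quot_trace_wr_act[OF Int_empty_left _ \<sigma> wr_act_P_gr[OF \<sigma>, of _ a, unfolded P]
          wr_act_C_gr[OF \<sigma>, of _ a, unfolded C]]) simp
qed

lemma chi_Delta_gr_eq:
  fixes a :: "nat \<Rightarrow> 'a::field_char_0"
  assumes "n \<ge> 1" and \<sigma>: "\<sigma> permutes {1..n}"
  shows "chi_Delta_gr n a \<sigma> = (\<Sum>i\<in>even_upto n. wr_char (row_part (n - i)) (col_part i) n a \<sigma>)"
  unfolding chi_Delta_gr_def P_gr_Int_C_gr[OF assms(1)] P_gr_Int_Id_gr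
  by (rule quot_trace_wr_act[OF odd_upto_Int_even_upto _ \<sigma>
        wr_act_C_gr[OF \<sigma>, of _ a, unfolded P_gr_Int_C_gr[OF assms(1)]]
        wr_act_Id_gr[OF \<sigma>, of _ a, unfolded P_gr_Int_Id_gr]]) simp

lemma sum_choose_even:
  assumes "n \<ge> 1"
  shows "(\<Sum>i\<in>even_upto n. n choose i) = 2 ^ (n - 1)"
proof -
  have "2 * int (\<Sum>i\<in>even_upto n. n choose i) = 2 ^ n"
    using choose_even_sum[of n, where ?'a = int] assms by (simp add: sum.If_cases Int_def)
  also have "\<dots> = 2 * int (2 ^ (n - 1))" using assms by (simp flip: power_Suc)
  finally show ?thesis by linarith
qed

lemma sum_choose_odd:
  assumes "n \<ge> 1"
  shows "(\<Sum>i\<in>odd_upto n. n choose i) = 2 ^ (n - 1)"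
proof -
  have "odd_upto n = {i. i \<le> n \<and> odd i}" by (auto simp: Suc_le_eq odd_pos)
  hence "2 * int (\<Sum>i\<in>odd_upto n. n choose i) = 2 ^ n"
    using choose_odd_sum[of n, where ?'a = int] assms by (simp add: sum.If_cases Int_def)
  also have "\<dots> = 2 * int (2 ^ (n - 1))" using assms by (simp flip: power_Suc)
  finally show ?thesis by linarith
qed

theorem theorem5p5:
  fixes F :: "'a::field_char_0 itself" and n :: nat
  assumes "n \<ge> 1"
  shows "c_gr_z F n = (\<Sum>i | 1 \<le> i \<and> i \<le> n \<and> odd i. n choose i)
       \<and> (\<Sum>i | 1 \<le> i \<and> i \<le> n \<and> odd i. n choose i) = 2 ^ (n - 1)
       \<and> delta_gr F n = (\<Sum>i | i \<le> n \<and> even i. n choose i)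
       \<and> (\<Sum>i | i \<le> n \<and> even i. n choose i) = 2 ^ (n - 1)
       \<and> (\<forall>(a :: nat \<Rightarrow> 'a) \<sigma>. \<sigma> permutes {1..n} \<and> (\<forall>j\<in>{1..n}. a j = 1 \<or> a j = -1) \<longrightarrow>
            chi_gr_z n a \<sigma> =
              (\<Sum>i | 1 \<le> i \<and> i \<le> n \<and> odd i. wr_char (row_part (n - i)) (col_part i) n a \<sigma>))
       \<and> (\<forall>(a :: nat \<Rightarrow> 'a) \<sigma>. \<sigma> permutes {1..n} \<and> (\<forall>j\<in>{1..n}. a j = 1 \<or> a j = -1) \<longrightarrow>
            chi_Delta_gr n a \<sigma> =
              (\<Sum>i | i \<le> n \<and> even i. wr_char (row_part (n - i)) (col_part i) n a \<sigma>))"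
  using c_gr_z_eq[OF assms] sum_choose_odd[OF assms] delta_gr_eq[OF assms] sum_choose_even[OF assms]
    chi_gr_z_eq[OF assms] chi_Delta_gr_eq[OF assms]
  by blast

end
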